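(* Fix a constant $\overline{\rho}<1/2$ and a fixed rational constant $\rho_{\mathbb{Q}}=p/q$ ($q\in\mathbb{Z}_{>0}$) with $\overline{\rho}<\rho_{\mathbb{Q}}<1/2$. Let $A\in\mathbb{Q}^{n\times n}$ be nonsingular with $\rho(|A^{-1}|)\le\overline{\rho}$, let $b\in\mathbb{Q}^n$, write $A=\bar A/d_A$, $b=\bar b/d_b$ with $\bar A\in\mathbb{Z}^{n\times n}$, $\bar b\in\mathbb{Z}^n$, $d_A,d_b\in\mathbb{Z}_{>0}$, and let $L=\max\{d_b,d_A,\|\bar b\|_\infty,\|\bar A\|_{\max}\}$. Let $w$ be the (positive, rational) solution of $(\rho_{\mathbb{Q}}I-|A^{-1}|^T)w=\mathbf{1}$, let $W_{\mathbb{Q}}=\operatorname{Diag}(w)$, and consider the preconditioned rational absolute value equation $\tilde A\tilde x-|\tilde x|=\tilde b$ with $\tilde A=W_{\mathbb{Q}}AW_{\mathbb{Q}}^{-1}$ and $\tilde b=W_{\mathbb{Q}}b$. Then: (i) $\|\tilde A^{-1}\|_1\le\rho_{\mathbb{Q}}<1/2$. (ii) Starting from any initial sign vector, the sign-flip algorithm applied to $\tilde A\tilde x-|\tilde x|=\tilde b$ finds its unique solution in finitely many iterations. (iii) Starting from any initial sign vector, the maximum number $T$ of iterations of the sign-flip algorithm applied to $\tilde A\tilde x-|\tilde x|=\tilde b$ with the $c(n)$-capture rule satisfies $T=\mathcal{O}\bigl(n^2\log(nL)/c(n)\bigr)$. In particular, $T=\mathcal{O}(n^3\log(nL))$ for either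 the steepest or the Gauss--Southwell single-flip rule, and $T=\mathcal{O}(n^2\log(nL))$ for the generalized Newton method (GNM).
   Context: $|X|$ and $|x|$ are entrywise; $\rho(\cdot)$ is the spectral radius; $\|\cdot\|_1$ for matrices is the maximum absolute column sum; $\|\cdot\|_\infty$ for vectors is the maximum absolute entry; $\|X\|_{\max}=\max_{i,j}|X_{ij}|$; $\mathbf{1}$ is the all-ones vector; $[n]=\{1,\dots,n\}$. Sign-flip algorithm applied to $\tilde A\tilde x-|\tilde x|=\tilde b$: initialize $z\in\{-1,1\}^n$, put $Z=\operatorname{Diag}(z)$, compute $\tilde x=(\tilde A-Z)^{-1}\tilde b$ and the mismatch set $\tilde{\mathcal{V}}_z=\{i\in[n]: z_i\tilde x_i<0\}$. While $\tilde{\mathcal{V}}_z\neq\emptyset$: select a nonempty subset $S\subseteq\tilde{\mathcal{V}}_z$ by some rule; replace $z_i$ by $-z_i$ for $i\in S$; recompute $Z$, $\tilde x$ and $\tilde{\mathcal{V}}_z$. When $\tilde{\mathcal{V}}_z=\emptyset$, return $\tilde x$. One pass through the while loop is one iteration. Selection rules, with $\tilde H=(\tilde A-Z)^{-1}$, $\tilde x=\tilde H\tilde b$, $\tilde y=\tilde H^Tz$: - $c(n)$-capture rule: $S\subseteq\tilde{\mathcal{V}}_z$ satisfies $\sum_{i\in S}|\tilde x_i|\ge c(n)\sum_{i\in\tilde{\mathcal{V}}_z}|\tilde x_i|$, where $c(n)\in(0,1]$ may depend on $n$ but not on the iteration index. - Gauss--Southwell single-flip rule: $S=\{k^*\}$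 with $k^*\in\arg\max_{i\in\tilde{\mathcal{V}}_z}|\tilde x_i|$. - Steepest single-flip rule: $S=\{k^*\}$ with $k^*\in\arg\max_{i\in\tilde{\mathcal{V}}_z}\frac{-2z_i\tilde x_i(1+\tilde y_i)}{1+2z_i\tilde H_{ii}}$ (the increase of $z^T(\tilde A-Z)^{-1}\tilde b$ upon flipping coordinate $i$). - GNM (full-flip rule): $S=\tilde{\mathcal{V}}_z$. The constants implied by $\mathcal{O}$ depend only on the fixed constants $\overline{\rho}$ and $\rho_{\mathbb{Q}}=p/q$. *)

theory Defs
  imports
    "Jordan_Normal_Form.Spectral_Radius"
    "Jordan_Normal_Form.Gauss_Jordan_Elimination"
begin

text \<open>Rows, columns and vector entries are indexed by \<open>0, \<dots>, n - 1\<close>.\<close>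

abbreviation abs_mat :: "real mat \<Rightarrow> real mat" where
  "abs_mat \<equiv> map_mat abs"

abbreviation abs_vec :: "real vec \<Rightarrow> real vec" where
  "abs_vec \<equiv> map_vec abs"

text \<open>Only meaningful for invertible matrices.\<close>

definition inv_mat :: "real mat \<Rightarrow> real mat" where
  "inv_mat A = the (mat_inverse A)"

definition Diag :: "real vec \<Rightarrow> real mat" where
  "Diag v = mat_diag (dim_vec v) (\<lambda>i. v $ i)"

text \<open>The library's spectral radius is the largest modulus of a complex eigenvalue.\<close>

definition real_spectral_radius :: "real mat \<Rightarrow> real" where
  "real_spectral_radius A = spectral_radius (map_mat complex_of_real A)"

text \<open>The three norms below are used in positive dimension only.\<close>

definition norm1_mat :: "real mat \<Rightarrow> real" where
  "norm1_mat A = Max ((\<lambda>j. \<Sum>i<dim_row A. \<bar>A $$ (i, j)\<bar>) ` {..<dim_col A})"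

definition max_norm_mat :: "int mat \<Rightarrow> int" where
  "max_norm_mat A = Max {\<bar>A $$ (i, j)\<bar> | i j. i < dim_row A \<and> j < dim_col A}"

definition inf_norm_vec :: "int vec \<Rightarrow> int" where
  "inf_norm_vec v = Max {\<bar>v $ i\<bar> | i. i < dim_vec v}"

definition ave_solution :: "real mat \<Rightarrow> real vec \<Rightarrow> real vec \<Rightarrow> bool" where
  "ave_solution A b x \<longleftrightarrow> x \<in> carrier_vec (dim_vec b) \<and> A *\<^sub>v x - abs_vec x = b"

definition sign_vec :: "nat \<Rightarrow> real vec \<Rightarrow> bool" where
  "sign_vec n z \<longleftrightarrow> z \<in> carrier_vec n \<and> (\<forall>i<n. z $ i \<in> {-1, 1})"

definition H_mat :: "real mat \<Rightarrow> real vec \<Rightarrow> real mat" where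
  "H_mat A z = inv_mat (A - Diag z)"

definition x_vec :: "real mat \<Rightarrow> real vec \<Rightarrow> real vec \<Rightarrow> real vec" where
  "x_vec A b z = H_mat A z *\<^sub>v b"

definition y_vec :: "real mat \<Rightarrow> real vec \<Rightarrow> real vec" where
  "y_vec A z = transpose_mat (H_mat A z) *\<^sub>v z"

definition mismatch :: "real mat \<Rightarrow> real vec \<Rightarrow> real vec \<Rightarrow> nat set" where
  "mismatch A b z = {i. i < dim_vec z \<and> z $ i * x_vec A b z $ i < 0}"

definition flip :: "nat set \<Rightarrow> real vec \<Rightarrow> real vec" where
  "flip S z = vec (dim_vec z) (\<lambda>i. if i \<in> S then - z $ i else z $ i)"

text \<open>
  A selection rule says which sets \<open>S\<close> may be flipped at the sign vector \<open>z\<close>, for the data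
  \<open>A\<close>, \<open>b\<close>. That \<open>S\<close> is a nonempty subset of the mismatch set is required by
  \<open>sign_flip_step\<close> and not repeated in the rules. Ties are resolved arbitrarily.
\<close>

type_synonym selection_rule = "real mat \<Rightarrow> real vec \<Rightarrow> real vec \<Rightarrow> nat set \<Rightarrow> bool"

text \<open>Every concrete rule, also one depending on the history of the run, refines this one.\<close>

definition any_rule :: selection_rule where
  "any_rule A b z S \<longleftrightarrow> True"

definition capture_rule :: "real \<Rightarrow> selection_rule" where
  "capture_rule c A b z S \<longleftrightarrow>
     (\<Sum>i\<in>S. \<bar>x_vec A b z $ i\<bar>) \<ge> c * (\<Sum>i\<in>mismatch A b z. \<bar>x_vec A b z $ i\<bar>)"

definition gauss_southwell_rule :: selection_rule where
  "gauss_southwell_rule A b z S \<longleftrightarrow>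
     (\<exists>k. S = {k} \<and> is_arg_max (\<lambda>i. \<bar>x_vec A b z $ i\<bar>) (\<lambda>i. i \<in> mismatch A b z) k)"

text \<open>
  The denominator is \<open>det (A - Diag (flip {i} z)) / det (A - Diag z)\<close>, hence nonzero as soon as
  all the matrices \<open>A - Diag z\<close> are invertible.
\<close>

definition flip_gain :: "real mat \<Rightarrow> real vec \<Rightarrow> real vec \<Rightarrow> nat \<Rightarrow> real" where
  "flip_gain A b z i =
     (- 2 * z $ i * x_vec A b z $ i * (1 + y_vec A z $ i)) / (1 + 2 * z $ i * H_mat A z $$ (i, i))"

definition steepest_rule :: selection_rule where
  "steepest_rule A b z S \<longleftrightarrow>
     (\<exists>k. S = {k} \<and> is_arg_max (flip_gain A b z) (\<lambda>i. i \<in> mismatch A b z) k)"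

definition full_flip_rule :: selection_rule where
  "full_flip_rule A b z S \<longleftrightarrow> S = mismatch A b z"

text \<open>
  One pass through the loop. It is possible only if the mismatch set is nonempty, because \<open>S\<close> is.
\<close>

definition sign_flip_step ::
    "real mat \<Rightarrow> real vec \<Rightarrow> selection_rule \<Rightarrow> real vec \<Rightarrow> real vec \<Rightarrow> bool" where
  "sign_flip_step A b R z z' \<longleftrightarrow>
     (\<exists>S. S \<noteq> {} \<and> S \<subseteq> mismatch A b z \<and> R A b z S \<and> z' = flip S z)"

text \<open>
  \<open>zs 0, \<dots>, zs T\<close> are the sign vectors of the first \<open>T\<close> iterations of a run, started from an
  arbitrary sign vector \<open>zs 0\<close>; the run has not necessarily stopped after them.
\<close>

definition sign_flip_run ::
    "real mat \<Rightarrow> real vec \<Rightarrow> selection_rule \<Rightarrow> (nat \<Rightarrow> real vec) \<Rightarrow> nat \<Rightarrow> bool" where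
  "sign_flip_run A b R zs T \<longleftrightarrow>
     sign_vec (dim_vec b) (zs 0) \<and> (\<forall>k<T. sign_flip_step A b R (zs k) (zs (Suc k)))"

text \<open>
  The algorithm is well defined (all systems it may have to solve are nonsingular), has no
  infinite run, and the vector it returns when it stops is the unique solution.
\<close>

definition sign_flip_finds_unique_solution :: "real mat \<Rightarrow> real vec \<Rightarrow> bool" where
  "sign_flip_finds_unique_solution A b \<longleftrightarrow>
     (\<forall>z. sign_vec (dim_vec b) z \<longrightarrow> invertible_mat (A - Diag z)) \<and>
     (\<exists>!x. ave_solution A b x) \<and>
     (\<nexists>zs. \<forall>T. sign_flip_run A b any_rule zs T) \<and>
     (\<forall>zs T. sign_flip_run A b any_rule zs T \<and> mismatch A b (zs T) = {} \<longrightarrow>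
        ave_solution A b (x_vec A b (zs T)))"

definition iterations_le :: "real mat \<Rightarrow> real vec \<Rightarrow> selection_rule \<Rightarrow> real \<Rightarrow> bool" where
  "iterations_le A b R B \<longleftrightarrow> (\<forall>zs T. sign_flip_run A b R zs T \<longrightarrow> real T \<le> B)"

end

theory Submission
  imports Defs
begin

text \<open>
  For sign vectors \<open>z\<close>, \<open>z'\<close> with \<open>x = (A - Z)\<^sup>-\<^sup>1 b\<close> and \<open>y' = (A - Z')\<^sup>-\<^sup>T z'\<close>, the potential
  \<open>f z = z \<bullet> x\<close> satisfies \<open>f z' - f z = (\<Sum>i. (z'\<^sub>i - z\<^sub>i) x\<^sub>i (1 + y'\<^sub>i))\<close>. If the column sums of
  \<open>\<bar>A\<^sup>-\<^sup>1\<bar>\<close> are at most \<open>r < 1/2\<close>, then \<open>\<bar>y'\<^sub>i\<bar> \<le> r / (1 - r) < 1\<close>. So flipping mismatched signs increases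
  \<open>f\<close>, and both the increase and the distance of \<open>f z\<close> to its maximum are comparable to the total mismatch:
  an iteration that captures the fraction \<open>c\<close> of the mismatch shrinks the gap to the maximum by the
  factor \<open>1 - c (1 - 2 r)\<close>. By Cramer's rule, \<open>f\<close> takes rational values whose numerators and denominators
  are at most \<open>(n L)\<close> to a power of order \<open>n\<^sup>2\<close>; the exponent is quadratic because the weights solve a
  linear system whose entries are themselves determinants. Hence the gap, while positive, is at least the
  inverse of such a number, which bounds the number of iterations.
\<close>

section \<open>Integer linear systems and inverses\<close>

text \<open>The Leibniz expansion has \<open>n!\<close> terms, each at most \<open>K ^ n\<close>,
  and \<open>n! <= n ^ n\<close>. Hadamard's inequality would be sharper, but only the logarithm of
  the bound enters the iteration count.\<close>

lemma abs_det_le: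
  fixes A :: "int mat"
  assumes A: "A \<in> carrier_mat n n"
    and bound: "\<And>i j. i < n \<Longrightarrow> j < n \<Longrightarrow> \<bar>A $$ (i, j)\<bar> \<le> K"
  shows "\<bar>det A\<bar> \<le> (int n * K) ^ n"
proof -
  have "\<bar>det A\<bar> \<le> (\<Sum>p\<in>{p. p permutes {0..<n}}. \<bar>signof p * (\<Prod>i = 0..<n. A $$ (i, p i))\<bar>)"
    unfolding det_def'[OF A] by (rule sum_abs)
  also have "\<dots> \<le> (\<Sum>p\<in>{p. p permutes {0..<n}}. K ^ n)"
  proof (rule sum_mono)
    fix p assume "p \<in> {p. p permutes {0..<n}}"
    then have p: "p permutes {0..<n}" by simp
    have "\<bar>signof p * (\<Prod>i = 0..<n. A $$ (i, p i))\<bar> = (\<Prod>i = 0..<n. \<bar>A $$ (i, p i)\<bar>)"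
      by (simp add: abs_mult abs_prod sign_def)
    also have "\<dots> \<le> (\<Prod>i = 0..<n. K)"
      using permutes_in_image[OF p] by (intro prod_mono) (auto intro!: bound)
    finally show "\<bar>signof p * (\<Prod>i = 0..<n. A $$ (i, p i))\<bar> \<le> K ^ n" by simp
  qed
  also have "\<dots> = fact n * K ^ n"
    by (simp add: card_permutations)
  also have "\<dots> \<le> int n ^ n * K ^ n"
  \<comment> \<open>\<open>0 <= K\<close> is read off from an entry, and there is one only for
    positive \<open>n\<close>.\<close>
  proof (cases "n = 0")
    case False
    then have "0 \<le> K" using bound[of 0 0] by linarith
    moreover have "(fact n :: int) \<le> int n ^ n"
      using fact_le_power[of n] by (metis of_nat_power)
    ultimately show ?thesis by (intro mult_right_mono) auto
  qed simp
  finally show ?thesis by (simp add: power_mult_distrib)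
qed

text \<open>Cramer's rule in division-free form: \<open>det M\<close> serves as one denominator for
  all coordinates, and each numerator is again an integer determinant, with column \<open>k\<close>
  replaced by \<open>v\<close>, so it obeys the same size bound.\<close>

lemma cramer_int:
  fixes M :: "int mat" and x :: "real vec"
  assumes M: "M \<in> carrier_mat n n" and v: "v \<in> carrier_vec n" and x: "x \<in> carrier_vec n"
    and eq: "map_mat real_of_int M *\<^sub>v x = map_vec real_of_int v"
    and k: "k < n"
    and boundM: "\<And>i j. i < n \<Longrightarrow> j < n \<Longrightarrow> \<bar>M $$ (i, j)\<bar> \<le> K"
    and boundv: "\<And>i. i < n \<Longrightarrow> \<bar>v $ i\<bar> \<le> K"
  shows "\<exists>u::int. real_of_int (det M) * x $ k = real_of_int u \<and> \<bar>u\<bar> \<le> (int n * K) ^ n"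
proof (intro exI conjI)
  let ?R = "replace_col M v k"
  have R: "?R \<in> carrier_mat n n" using M by (simp add: replace_col_def)
  have "x $ k * det (map_mat real_of_int M) = det (replace_col (map_mat real_of_int M) (map_vec real_of_int v) k)"
    using cramer_lemma_mat[of "map_mat real_of_int M" n x k] M x k by (simp add: eq)
  also have "replace_col (map_mat real_of_int M) (map_vec real_of_int v) k = map_mat real_of_int ?R"
    using M v by (intro eq_matI) (auto simp: replace_col_def)
  finally show "real_of_int (det M) * x $ k = real_of_int (det ?R)"
    by (simp add: of_int_hom.hom_det mult.commute)
  show "\<bar>det ?R\<bar> \<le> (int n * K) ^ n"
    using M by (intro abs_det_le[OF R]) (auto simp: replace_col_def boundM boundv)
qed

lemma index_mult_mat_vec_sum:
  "A \<in> carrier_mat m n \<Longrightarrow> v \<in> carrier_vec n \<Longrightarrow> i < m \<Longrightarrow>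
    (A *\<^sub>v v) $ i = (\<Sum>j<n. A $$ (i, j) * v $ j)"
  by (simp add: scalar_prod_def lessThan_atLeast0)

text \<open>\<open>mat_inverse\<close> is specified through the units of the ring of square
  matrices. \<open>invertible_mat\<close> leaves the shape of the inverse open, so \<open>B\<close>
  is first shown to be square by comparing shapes with the identity matrices.\<close>

lemma inv_mat:
  fixes M :: "real mat"
  assumes M: "M \<in> carrier_mat n n" and inv: "invertible_mat M"
  shows "inv_mat M \<in> carrier_mat n n" "M * inv_mat M = 1\<^sub>m n" "inv_mat M * M = 1\<^sub>m n"
proof -
  obtain B where B: "M * B = 1\<^sub>m n" "B * M = 1\<^sub>m (dim_row B)"
    using inv M by (auto simp: invertible_mat_def inverts_mat_def)
  have "dim_row B = n" "dim_col B = n"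
    using arg_cong[OF B(1), of dim_col] arg_cong[OF B(2), of dim_col] M by auto
  then have "M \<in> Units (ring_mat TYPE(real) n ())"
    using B M by (auto simp: Units_def ring_mat_simps intro!: bexI[of _ B])
  then obtain C where "mat_inverse M = Some C"
    using mat_inverse(1)[OF M, of "()"] by (cases "mat_inverse M") auto
  then show "inv_mat M \<in> carrier_mat n n" "M * inv_mat M = 1\<^sub>m n" "inv_mat M * M = 1\<^sub>m n"
    using mat_inverse(2)[OF M, of C] by (auto simp: inv_mat_def)
qed

lemma inv_mat_unique:
  assumes M: "M \<in> carrier_mat n n" and N: "N \<in> carrier_mat n n" and NM: "N * M = 1\<^sub>m n"
    and inv: "invertible_mat M"
  shows "inv_mat M = N"
proof -
  note i = inv_mat[OF M inv]
  have "inv_mat M = (N * M) * inv_mat M" using i NM by simp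
  also have "\<dots> = N * (M * inv_mat M)" using M N i by (intro assoc_mult_mat) auto
  finally show ?thesis using i N by simp
qed

lemma invertible_matI:
  "M \<in> carrier_mat n n \<Longrightarrow> N \<in> carrier_mat n n \<Longrightarrow> M * N = 1\<^sub>m n \<Longrightarrow> N * M = 1\<^sub>m n \<Longrightarrow> invertible_mat M"
  by (auto simp: invertible_mat_def inverts_mat_def)

text \<open>For square matrices over a field, injectivity suffices. This is the criterion for the
  matrices below that come without an explicit inverse.\<close>

lemma invertible_matI_kernel:
  fixes M :: "real mat"
  assumes M: "M \<in> carrier_mat n n"
    and ker: "\<And>v. v \<in> carrier_vec n \<Longrightarrow> M *\<^sub>v v = 0\<^sub>v n \<Longrightarrow> v = 0\<^sub>v n"
  shows "invertible_mat M"
proof -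
  have "det M \<noteq> 0" using det_0_iff_vec_prod_zero_field[OF M] ker by blast
  from det_non_zero_imp_unit[OF M this, of "()"] obtain B where "B \<in> carrier_mat n n" "B * M = 1\<^sub>m n" "M * B = 1\<^sub>m n"
    by (auto simp: Units_def ring_mat_simps)
  then show ?thesis using M by (auto simp: invertible_mat_def inverts_mat_def)
qed

lemma invertible_mat_det_nonzero:
  fixes M :: "real mat"
  assumes M: "M \<in> carrier_mat n n" and inv: "invertible_mat M"
  shows "det M \<noteq> 0"
  using det_mult[OF M inv_mat(1)[OF M inv]] inv_mat(2)[OF M inv] by auto

section \<open>Nonnegative matrices of small spectral radius\<close>

lemma smult_mat_mult_vec:
  fixes M :: "'a :: comm_ring_1 mat"
  assumes "M \<in> carrier_mat m n" "v \<in> carrier_vec n"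
  shows "(a \<cdot>\<^sub>m M) *\<^sub>v v = a \<cdot>\<^sub>v (M *\<^sub>v v)"
  using assms by (intro eq_vecI) (auto simp: scalar_prod_def sum_distrib_left mult.assoc)

text \<open>Dividing by \<open>s\<close> moves all eigenvalues into the open unit disc, where the
  Jordan normal form bounds all powers by one constant. The transpose appears because the weights
  are governed by the columns of \<open>B\<close>.\<close>

lemma spectral_radius_power_bounded:
  fixes B :: "real mat"
  assumes B: "B \<in> carrier_mat n n" and n: "n > 0" and s: "real_spectral_radius B < s"
  obtains c where "\<And>k i j. i < n \<Longrightarrow> j < n \<Longrightarrow> \<bar>(((1 / s) \<cdot>\<^sub>m transpose_mat B) ^\<^sub>m k) $$ (i, j)\<bar> \<le> c"
    "0 < s"
proof -
  let ?B = "map_mat complex_of_real B" and ?P = "(1 / s) \<cdot>\<^sub>m transpose_mat B"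
  let ?Q = "map_mat complex_of_real ?P"
  have cB: "?B \<in> carrier_mat n n" "transpose_mat ?B \<in> carrier_mat n n" and Q: "?Q \<in> carrier_mat n n" and P: "?P \<in> carrier_mat n n" using B by auto
  have "0 \<le> real_spectral_radius B"
    using spectral_radius_mem_max(1)[OF cB(1) n] unfolding real_spectral_radius_def by auto
  then have s0: "0 < s" using s by simp
  have "cmod e < 1" if e: "eigenvalue ?Q e" for e
  proof -
    obtain v where v: "v \<in> carrier_vec n" "v \<noteq> 0\<^sub>v n" "?Q *\<^sub>v v = e \<cdot>\<^sub>v v"
      using e carrier_matD(1)[OF Q] unfolding eigenvalue_def eigenvector_def by auto
    \<comment> \<open>An eigenvector of \<open>?Q\<close> for \<open>e\<close> is one of the
      transpose of \<open>?B\<close> for \<open>s * e\<close>. Transposition preserves the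
      characteristic polynomial, so \<open>s * e\<close> is an eigenvalue of \<open>?B\<close> as
      well.\<close>
    have "transpose_mat ?B = complex_of_real s \<cdot>\<^sub>m ?Q"
      using B s0 by (intro eq_matI) auto
    then have "transpose_mat ?B *\<^sub>v v = (complex_of_real s \<cdot>\<^sub>m ?Q) *\<^sub>v v" by simp
    also have "\<dots> = complex_of_real s \<cdot>\<^sub>v (?Q *\<^sub>v v)" using Q v(1) by (simp add: smult_mat_mult_vec)
    also have "\<dots> = (s * e) \<cdot>\<^sub>v v" using v by (simp add: smult_smult_assoc)
    finally have "eigenvalue (transpose_mat ?B) (s * e)"
      using v cB by (auto simp: eigenvalue_def eigenvector_def)
    then have "eigenvalue ?B (s * e)"
      using eigenvalue_root_char_poly[OF cB(1)] eigenvalue_root_char_poly[OF cB(2)] char_poly_transpose_mat[OF cB(1)] by simp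
    then have "cmod (s * e) \<le> real_spectral_radius B"
      using spectral_radius_mem_max(2)[OF cB(1) n] unfolding real_spectral_radius_def
      by (auto simp: spectrum_def)
    then have "s * cmod e \<le> real_spectral_radius B" using s0 by (simp add: norm_mult)
    then have "s * cmod e < s * 1" using s by linarith
    then show ?thesis using s0 by (simp only: mult_less_cancel_left_pos)
  qed
  then have "spectral_radius ?Q < 1"
    using spectral_radius_mem_max(1)[OF Q n] by (auto simp: spectrum_def)
  then obtain c where c: "\<And>k. norm_bound (?Q ^\<^sub>m k) c"
    using spectral_radius_jnf_norm_bound_less_1_upper_triangular[OF Q] by blast
  have "\<bar>(?P ^\<^sub>m k) $$ (i, j)\<bar> \<le> c" if "i < n" "j < n" for k i j
  proof -
    have "?Q ^\<^sub>m k = map_mat complex_of_real (?P ^\<^sub>m k)"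
      by (rule of_real_hom.mat_hom_pow[OF P, symmetric])
    moreover have "?P ^\<^sub>m k \<in> carrier_mat n n" using P by (rule pow_carrier_mat)
    ultimately have "norm ((?Q ^\<^sub>m k) $$ (i, j)) = \<bar>(?P ^\<^sub>m k) $$ (i, j)\<bar>"
      using that by (simp del: pow_mat_dim)
    moreover have "?Q ^\<^sub>m k \<in> carrier_mat n n" using Q by (rule pow_carrier_mat)
    ultimately show ?thesis
      using c[of k] that unfolding norm_bound_def by (metis carrier_matD)
  qed
  then show ?thesis using s0 that by blast
qed

text \<open>Iterating the hypothesis gives \<open>v \<ge> (B\<^sup>T / \<rho>)\<^sup>k v\<close>, and the right-hand side tends to \<open>0\<close>.\<close>

lemma nonneg_of_spectral_radius_less:
  fixes B :: "real mat"
  assumes B: "B \<in> carrier_mat n n" and nonneg: "\<And>i j. i < n \<Longrightarrow> j < n \<Longrightarrow> 0 \<le> B $$ (i, j)"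
    and \<rho>: "real_spectral_radius B < \<rho>" and v: "v \<in> carrier_vec n"
    and sup: "\<And>j. j < n \<Longrightarrow> (\<Sum>i<n. B $$ (i, j) * v $ i) \<le> \<rho> * v $ j"
    and k: "k < n"
  shows "0 \<le> v $ k"
proof -
  \<comment> \<open>With \<open>s\<close> strictly in between, the powers of the transpose of
    \<open>B\<close> divided by \<open>s\<close> stay bounded, which leaves the factor
    \<open>(s / \<rho>) ^ m\<close> to tend to zero.\<close>
  obtain s where s: "real_spectral_radius B < s" "s < \<rho>" using dense[OF \<rho>] by blast
  have "n > 0" using k by simp
  from spectral_radius_power_bounded[OF B this s(1)] obtain c
    where c: "\<And>k i j. i < n \<Longrightarrow> j < n \<Longrightarrow> \<bar>(((1 / s) \<cdot>\<^sub>m transpose_mat B) ^\<^sub>m k) $$ (i, j)\<bar> \<le> c"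
    and s0: "0 < s" by blast
  define P where "P = (1 / s) \<cdot>\<^sub>m transpose_mat B"
  have P: "P \<in> carrier_mat n n" using B by (simp add: P_def)
  have P_nonneg: "0 \<le> P $$ (i, j)" if "i < n" "j < n" for i j
    using that B nonneg s0 by (simp add: P_def)
  have sup': "(s / \<rho>) * (\<Sum>i<n. P $$ (j, i) * v $ i) \<le> v $ j" if "j < n" for j
  proof -
    have "(\<Sum>i<n. P $$ (j, i) * v $ i) = (\<Sum>i<n. B $$ (i, j) * v $ i) / s"
      unfolding sum_divide_distrib using that B by (intro sum.cong) (auto simp: P_def)
    then show ?thesis using sup[OF that] s s0 by (simp add: field_simps)
  qed
  \<comment> \<open>Nonnegativity of the powers is carried along in the induction because
    \<open>sup'\<close> gets multiplied by their entries.\<close>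
  have iter: "(s / \<rho>) ^ m * (\<Sum>i<n. (P ^\<^sub>m m) $$ (j, i) * v $ i) \<le> v $ j \<and> (\<forall>i<n. 0 \<le> (P ^\<^sub>m m) $$ (j, i))" if "j < n" for m j
  proof (induction m)
    case 0
    have "(\<Sum>i<n. (1\<^sub>m n) $$ (j, i) * v $ i) = (\<Sum>i<n. if i = j then v $ i else 0)"
      using that by (intro sum.cong) auto
    then show ?case using that P by (simp add: one_mat_def)
  next
    case (Suc m)
    let ?P = "P ^\<^sub>m m"
    have Pm: "?P \<in> carrier_mat n n" using P by (rule pow_carrier_mat)
    have ent: "(?P * P) $$ (j, i) = (\<Sum>l<n. ?P $$ (j, l) * P $$ (l, i))" if "i < n" for i
      using that \<open>j < n\<close> P Pm by (simp add: scalar_prod_def lessThan_atLeast0)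
    have "(\<Sum>i<n. (?P * P) $$ (j, i) * v $ i) = (\<Sum>i<n. \<Sum>l<n. ?P $$ (j, l) * P $$ (l, i) * v $ i)"
      using ent by (intro sum.cong) (auto simp: sum_distrib_right)
    also have "\<dots> = (\<Sum>l<n. ?P $$ (j, l) * (\<Sum>i<n. P $$ (l, i) * v $ i))"
      by (subst sum.swap) (simp add: sum_distrib_left mult.assoc)
    finally have "(s / \<rho>) * (\<Sum>i<n. (?P * P) $$ (j, i) * v $ i)
        = (\<Sum>l<n. ?P $$ (j, l) * ((s / \<rho>) * (\<Sum>i<n. P $$ (l, i) * v $ i)))"
      by (simp add: sum_distrib_left mult_ac)
    also have "\<dots> \<le> (\<Sum>l<n. ?P $$ (j, l) * v $ l)"
      using Suc sup' by (intro sum_mono mult_left_mono) auto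
    finally have "(s / \<rho>) ^ m * ((s / \<rho>) * (\<Sum>i<n. (?P * P) $$ (j, i) * v $ i))
        \<le> (s / \<rho>) ^ m * (\<Sum>l<n. ?P $$ (j, l) * v $ l)"
      using s s0 by (intro mult_left_mono) auto
    moreover have "\<forall>i<n. 0 \<le> (?P * P) $$ (j, i)"
      using ent Suc P_nonneg by (auto intro!: sum_nonneg)
    ultimately show ?case using Suc by (simp add: mult_ac)
  qed
  have "- ((s / \<rho>) ^ m * (c * (\<Sum>i<n. \<bar>v $ i\<bar>))) \<le> v $ k" for m
  proof -
    have "\<bar>\<Sum>i<n. (P ^\<^sub>m m) $$ (k, i) * v $ i\<bar> \<le> (\<Sum>i<n. c * \<bar>v $ i\<bar>)"
      using c k unfolding P_def
      by (intro order_trans[OF sum_abs] sum_mono) (auto simp: abs_mult intro!: mult_right_mono)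
    then have "- (c * (\<Sum>i<n. \<bar>v $ i\<bar>)) \<le> (\<Sum>i<n. (P ^\<^sub>m m) $$ (k, i) * v $ i)"
      by (simp add: sum_distrib_left abs_le_iff)
    then have "(s / \<rho>) ^ m * - (c * (\<Sum>i<n. \<bar>v $ i\<bar>)) \<le> (s / \<rho>) ^ m * (\<Sum>i<n. (P ^\<^sub>m m) $$ (k, i) * v $ i)"
      using s s0 by (intro mult_left_mono) auto
    then show ?thesis using iter[OF k, of m] by simp
  qed
  moreover have "(\<lambda>m. - ((s / \<rho>) ^ m * (c * (\<Sum>i<n. \<bar>v $ i\<bar>)))) \<longlonglongrightarrow> - (0 * (c * (\<Sum>i<n. \<bar>v $ i\<bar>)))"
    using s s0 by (intro tendsto_intros LIMSEQ_realpow_zero) auto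
  ultimately show ?thesis by (intro LIMSEQ_le_const2[where a = "v $ k"]) auto
qed

section \<open>The sign-flip algorithm for a contracting equation\<close>

lemma sum_of_bool_mult_index:
  "i < (n::nat) \<Longrightarrow> (\<Sum>j<n. (if i = j then f j else 0) * g j) = f i * (g i :: real)"
  by (simp add: if_distrib[where f = "\<lambda>x. x * _"] cong: if_cong)

lemma Diag_carrier [simp]: "v \<in> carrier_vec n \<Longrightarrow> Diag v \<in> carrier_mat n n"
  by (simp add: Diag_def)

lemma dim_Diag [simp]: "dim_row (Diag v) = dim_vec v" "dim_col (Diag v) = dim_vec v"
  by (simp_all add: Diag_def mat_diag_def)

lemma index_Diag [simp]:
  "i < dim_vec v \<Longrightarrow> j < dim_vec v \<Longrightarrow> Diag v $$ (i, j) = (if i = j then v $ j else 0)"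
  by (simp add: Diag_def mat_diag_def)

lemma index_sub_Diag_mult_vec:
  assumes "A \<in> carrier_mat n n" "z \<in> carrier_vec n" "v \<in> carrier_vec n" "i < n"
  shows "((A - Diag z) *\<^sub>v v) $ i = (\<Sum>j<n. A $$ (i, j) * v $ j) - z $ i * v $ i"
proof -
  have "((A - Diag z) *\<^sub>v v) $ i = (\<Sum>j<n. A $$ (i, j) * v $ j - (if i = j then z $ j else 0) * v $ j)"
    using assms by (subst index_mult_mat_vec_sum[of _ n n]) (auto simp: minus_carrier_mat left_diff_distrib intro!: sum.cong)
  then show ?thesis using assms(4) by (simp add: sum_subtractf sum_of_bool_mult_index)
qed

lemma sign_vec_carrier: "sign_vec n z \<Longrightarrow> z \<in> carrier_vec n"
  by (simp add: sign_vec_def)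

lemma sign_vec_cases: "sign_vec n z \<Longrightarrow> i < n \<Longrightarrow> z $ i = 1 \<or> z $ i = - 1"
  by (auto simp: sign_vec_def)

lemma finite_sign_vec: "finite {z. sign_vec n z}"
proof (rule finite_subset)
  show "{z. sign_vec n z} \<subseteq> vec n ` ({..<n} \<rightarrow>\<^sub>E {-1, 1})"
  proof
    fix z assume "z \<in> {z. sign_vec n z}"
    then have "z = vec n (restrict (($) z) {..<n})" "restrict (($) z) {..<n} \<in> {..<n} \<rightarrow>\<^sub>E {-1, 1}"
      by (auto simp: sign_vec_def)
    then show "z \<in> vec n ` ({..<n} \<rightarrow>\<^sub>E {-1, 1})" by blast
  qed
qed (simp add: finite_PiE)

section \<open>Equations whose inverse matrix has column sums below one half\<close>

text \<open>The inverse \<open>Ai\<close> is a parameter next to \<open>A\<close>, so that an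
  explicitly known inverse can be plugged in. \<open>col_sum\<close> says that the induced 1-norm of
  \<open>Ai\<close> is at most \<open>r\<close>.\<close>

locale contracting_ave =
  fixes n :: nat and A Ai :: "real mat" and b :: "real vec" and r :: real
  assumes A: "A \<in> carrier_mat n n" and Ai: "Ai \<in> carrier_mat n n" and b: "b \<in> carrier_vec n"
    and A_Ai: "A * Ai = 1\<^sub>m n" and Ai_A: "Ai * A = 1\<^sub>m n"
    and col_sum: "\<And>j. j < n \<Longrightarrow> (\<Sum>i<n. \<bar>Ai $$ (i, j)\<bar>) \<le> r"
    and r0: "0 \<le> r" and r_half: "r < 1 / 2"
begin

text \<open>Write \<open>v = Ai (A v)\<close>; exchanging the two sums produces the column sums of
  \<open>Ai\<close>.\<close>

lemma sum_abs_le: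
  assumes v: "v \<in> carrier_vec n"
  shows "(\<Sum>i<n. \<bar>v $ i\<bar>) \<le> r * (\<Sum>i<n. \<bar>(A *\<^sub>v v) $ i\<bar>)"
proof -
  let ?u = "A *\<^sub>v v"
  have u: "?u \<in> carrier_vec n" using A v by auto
  have "v = Ai *\<^sub>v ?u" using A Ai v Ai_A by (simp flip: assoc_mult_mat_vec)
  then have "v $ i = (\<Sum>j<n. Ai $$ (i, j) * ?u $ j)" if "i < n" for i
    using index_mult_mat_vec_sum[OF Ai u that] by simp
  then have "(\<Sum>i<n. \<bar>v $ i\<bar>) \<le> (\<Sum>i<n. \<Sum>j<n. \<bar>Ai $$ (i, j)\<bar> * \<bar>?u $ j\<bar>)"
    by (intro sum_mono) (auto simp: abs_mult[symmetric] intro!: sum_abs simp del: index_mult_mat_vec)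
  also have "\<dots> = (\<Sum>j<n. (\<Sum>i<n. \<bar>Ai $$ (i, j)\<bar>) * \<bar>?u $ j\<bar>)"
    by (subst sum.swap) (simp add: sum_distrib_right)
  also have "\<dots> \<le> (\<Sum>j<n. r * \<bar>?u $ j\<bar>)"
    using col_sum by (intro sum_mono mult_right_mono) auto
  finally show ?thesis by (simp add: sum_distrib_left)
qed

text \<open>The dual estimate: rows of the transposed inverse are columns of \<open>Ai\<close>, so
  the same \<open>r\<close> controls the maximum norm in the transposed system.\<close>

lemma abs_le_of_transpose:
  assumes y: "y \<in> carrier_vec n" and M: "\<And>i. i < n \<Longrightarrow> \<bar>(transpose_mat A *\<^sub>v y) $ i\<bar> \<le> M"
    and j: "j < n"
  shows "\<bar>y $ j\<bar> \<le> r * M"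
proof -
  let ?u = "transpose_mat A *\<^sub>v y"
  have u: "?u \<in> carrier_vec n" using A y by auto
  have "transpose_mat Ai * transpose_mat A = 1\<^sub>m n"
    using transpose_mult[OF A Ai] A_Ai by simp
  then have "y = transpose_mat Ai *\<^sub>v ?u" using A Ai y by (simp flip: assoc_mult_mat_vec)
  then have "y $ j = (\<Sum>i<n. Ai $$ (i, j) * ?u $ i)"
    using index_mult_mat_vec_sum[of "transpose_mat Ai" n n, OF _ u j] Ai j by simp
  then have "\<bar>y $ j\<bar> \<le> (\<Sum>i<n. \<bar>Ai $$ (i, j)\<bar> * \<bar>?u $ i\<bar>)"
    by (auto simp: abs_mult[symmetric] intro!: sum_abs simp del: index_mult_mat_vec)
  also have "\<dots> \<le> (\<Sum>i<n. \<bar>Ai $$ (i, j)\<bar> * M)"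
    using M by (intro sum_mono mult_left_mono) auto
  also have "\<dots> \<le> r * M"
    unfolding sum_distrib_right[symmetric] using col_sum[OF j] M[OF j]
    by (intro mult_right_mono) auto
  finally show ?thesis .
qed

text \<open>For \<open>d = u - v\<close> the hypothesis and \<open>sum_abs_le\<close> give that the
  1-norm of \<open>d\<close> is at most \<open>r\<close> times itself, so \<open>d = 0\<close>. This
  yields both the invertibility of \<open>A - Z\<close> (with \<open>v = 0\<close>) and the
  uniqueness of the solution (by the reverse triangle inequality).\<close>

lemma ave_contraction:
  assumes "u \<in> carrier_vec n" "v \<in> carrier_vec n"
    and le: "\<And>i. i < n \<Longrightarrow> \<bar>(A *\<^sub>v (u - v)) $ i\<bar> \<le> \<bar>u $ i - v $ i\<bar>"
  shows "u = v"
proof -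
  have "(\<Sum>i<n. \<bar>(u - v) $ i\<bar>) \<le> r * (\<Sum>i<n. \<bar>(A *\<^sub>v (u - v)) $ i\<bar>)"
    using assms by (intro sum_abs_le) auto
  also have "\<dots> \<le> r * (\<Sum>i<n. \<bar>(u - v) $ i\<bar>)"
    using assms r0 by (intro mult_left_mono sum_mono) (auto simp del: index_mult_mat_vec)
  finally have "(1 - r) * (\<Sum>i<n. \<bar>(u - v) $ i\<bar>) \<le> 0" by (simp add: algebra_simps)
  moreover have "0 \<le> (\<Sum>i<n. \<bar>(u - v) $ i\<bar>)" by (simp add: sum_nonneg)
  ultimately have "(\<Sum>i<n. \<bar>(u - v) $ i\<bar>) = 0"
    using r_half by (auto simp: mult_le_0_iff)
  then have "\<forall>i<n. \<bar>(u - v) $ i\<bar> = 0" by (subst (asm) sum_nonneg_eq_0_iff) auto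
  then show ?thesis using assms by (intro eq_vecI) auto
qed

text \<open>A kernel vector satisfies \<open>A v = Z v\<close>, whose entries have the same moduli
  as those of \<open>v\<close>.\<close>

lemma invertible_sub_Diag:
  assumes z: "sign_vec n z"
  shows "invertible_mat (A - Diag z)"
proof (rule invertible_matI_kernel)
  note zc = sign_vec_carrier[OF z]
  show "A - Diag z \<in> carrier_mat n n" using A zc by (simp add: minus_carrier_mat)
  fix v assume v: "v \<in> carrier_vec n" and 0: "(A - Diag z) *\<^sub>v v = 0\<^sub>v n"
  show "v = 0\<^sub>v n"
  proof (rule ave_contraction[OF v])
    fix i assume i: "i < n"
    have "(A *\<^sub>v (v - 0\<^sub>v n)) $ i = z $ i * v $ i"
      using index_sub_Diag_mult_vec[OF A zc v i] 0 i A v index_mult_mat_vec_sum[OF A v i]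
      by (simp del: index_mult_mat_vec)
    then show "\<bar>(A *\<^sub>v (v - 0\<^sub>v n)) $ i\<bar> \<le> \<bar>v $ i - 0\<^sub>v n $ i\<bar>"
      using sign_vec_cases[OF z i] i by (auto simp del: index_mult_mat_vec)
  qed simp
qed

lemma H_mat:
  assumes z: "sign_vec n z"
  shows "H_mat A z \<in> carrier_mat n n" "(A - Diag z) * H_mat A z = 1\<^sub>m n"
    "H_mat A z * (A - Diag z) = 1\<^sub>m n"
  using inv_mat[OF _ invertible_sub_Diag[OF z], of n] A sign_vec_carrier[OF z]
  by (simp_all add: H_mat_def minus_carrier_mat)

lemma x_vec_carrier: "sign_vec n z \<Longrightarrow> x_vec A b z \<in> carrier_vec n"
  using H_mat(1) b unfolding x_vec_def by (metis mult_mat_vec_carrier)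

lemma x_vec:
  assumes z: "sign_vec n z"
  shows "(A - Diag z) *\<^sub>v x_vec A b z = b"
proof -
  have "A - Diag z \<in> carrier_mat n n" using A sign_vec_carrier[OF z] by (simp add: minus_carrier_mat)
  then show ?thesis
    using H_mat[OF z] b unfolding x_vec_def by (simp flip: assoc_mult_mat_vec)
qed

lemma x_vec_index:
  assumes z: "sign_vec n z" and i: "i < n"
  shows "(\<Sum>j<n. A $$ (i, j) * x_vec A b z $ j) = b $ i + z $ i * x_vec A b z $ i"
  using index_sub_Diag_mult_vec[OF A sign_vec_carrier[OF z] x_vec_carrier[OF z] i] x_vec[OF z]
  by simp

lemma y_vec_carrier: "sign_vec n z \<Longrightarrow> y_vec A z \<in> carrier_vec n"
  using H_mat(1) sign_vec_carrier unfolding y_vec_def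
  by (metis mult_mat_vec_carrier transpose_carrier_mat)

lemma y_vec_index:
  assumes z: "sign_vec n z" and i: "i < n"
  shows "(\<Sum>j<n. A $$ (j, i) * y_vec A z $ j) = z $ i + z $ i * y_vec A z $ i"
proof -
  note zc = sign_vec_carrier[OF z]
  have T: "transpose_mat (A - Diag z) = transpose_mat A - Diag z"
    using A zc by (intro eq_matI) (auto simp: minus_carrier_mat Diag_def mat_diag_def)
  have "transpose_mat (A - Diag z) * transpose_mat (H_mat A z) = 1\<^sub>m n"
    using transpose_mult[OF H_mat(1)[OF z], of "A - Diag z" n] H_mat(3)[OF z] A zc
    by (simp add: minus_carrier_mat)
  moreover have "transpose_mat A - Diag z \<in> carrier_mat n n"
    using A zc by (simp add: minus_carrier_mat)
  ultimately have "(transpose_mat A - Diag z) *\<^sub>v y_vec A z = z"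
    using H_mat(1)[OF z] zc unfolding y_vec_def T by (simp flip: assoc_mult_mat_vec)
  then show ?thesis
    using index_sub_Diag_mult_vec[of "transpose_mat A" n z, OF _ zc y_vec_carrier[OF z] i] A i
    by simp
qed

text \<open>If \<open>m\<close> is the maximum norm of \<open>y\<close>, then the transposed
  \<open>A\<close> maps \<open>y\<close> to \<open>z + Z y\<close>, with entries at most
  \<open>1 + m\<close> in modulus. Hence \<open>m <= r * (1 + m)\<close>, and solving for
  \<open>m\<close> gives the bound.\<close>

lemma abs_y_vec_le:
  assumes z: "sign_vec n z" and i: "i < n"
  shows "\<bar>y_vec A z $ i\<bar> \<le> r / (1 - r)"
proof -
  let ?y = "y_vec A z"
  define m where "m = Max ((\<lambda>i. \<bar>?y $ i\<bar>) ` {..<n})"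
  have le: "\<bar>?y $ j\<bar> \<le> m" if "j < n" for j
    unfolding m_def using that by (intro Max_ge) auto
  have "m \<in> (\<lambda>i. \<bar>?y $ i\<bar>) ` {..<n}" unfolding m_def using i by (intro Max_in) auto
  then obtain k where k: "k < n" "m = \<bar>?y $ k\<bar>" by auto
  have "\<bar>?y $ k\<bar> \<le> r * (1 + m)"
  proof (rule abs_le_of_transpose[OF y_vec_carrier[OF z] _ k(1)])
    fix j assume j: "j < n"
    have "(transpose_mat A *\<^sub>v ?y) $ j = z $ j + z $ j * ?y $ j"
      using index_mult_mat_vec_sum[of "transpose_mat A" n n ?y j] y_vec_carrier[OF z] A j y_vec_index[OF z j]
      by simp
    then show "\<bar>(transpose_mat A *\<^sub>v ?y) $ j\<bar> \<le> 1 + m"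
      using sign_vec_cases[OF z j] le[OF j] by (auto simp del: index_mult_mat_vec)
  qed
  then have "m \<le> r / (1 - r)" using k r_half by (simp add: field_simps)
  then show ?thesis using le[OF i] by simp
qed

text \<open>The bounds are \<open>1 - r / (1 - r)\<close> and \<open>1 + r / (1 - r)\<close>. The
  threshold \<open>r < 1 / 2\<close> is what makes the lower one positive.\<close>

lemma one_plus_y_vec:
  assumes z: "sign_vec n z" and i: "i < n"
  shows "(1 - 2 * r) / (1 - r) \<le> 1 + y_vec A z $ i" "1 + y_vec A z $ i \<le> 1 / (1 - r)"
    "0 < 1 + y_vec A z $ i"
proof -
  have "(1 - 2 * r) / (1 - r) = 1 - r / (1 - r)" "1 / (1 - r) = 1 + r / (1 - r)" "0 < (1 - 2 * r) / (1 - r)"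
    using r_half by (simp_all add: field_simps)
  then show "(1 - 2 * r) / (1 - r) \<le> 1 + y_vec A z $ i" "1 + y_vec A z $ i \<le> 1 / (1 - r)"
    "0 < 1 + y_vec A z $ i"
    using abs_y_vec_le[OF z i] by linarith+
qed

section \<open>The potential and its increments\<close>

definition potential :: "real vec \<Rightarrow> real" where
  "potential z = (\<Sum>i<n. z $ i * x_vec A b z $ i)"

text \<open>The dual vector at \<open>z'\<close> is paired with the primal vector at
  \<open>z\<close>: the signs of the latter are known at the current iterate, while the former is
  bounded uniformly over all sign vectors.\<close>

lemma potential_diff:
  assumes z: "sign_vec n z" and z': "sign_vec n z'"
  shows "potential z' - potential z =
    (\<Sum>i<n. (z' $ i - z $ i) * x_vec A b z $ i * (1 + y_vec A z' $ i))"
proof -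
  let ?x = "x_vec A b z" and ?x' = "x_vec A b z'" and ?y = "y_vec A z'"
  \<comment> \<open>The factor \<open>z'\<close> is replaced by the transposed \<open>A\<close>
    applied to \<open>?y\<close>, minus \<open>Z' ?y\<close>; after exchanging sums,
    \<open>A\<close> acts on \<open>?x' - ?x\<close>.\<close>
  have "(\<Sum>i<n. z' $ i * (?x' $ i - ?x $ i)) =
      (\<Sum>i<n. (\<Sum>j<n. A $$ (j, i) * ?y $ j) * (?x' $ i - ?x $ i) - z' $ i * ?y $ i * (?x' $ i - ?x $ i))"
    using y_vec_index[OF z'] by (intro sum.cong) (auto simp: algebra_simps)
  also have "\<dots> = (\<Sum>i<n. \<Sum>j<n. A $$ (j, i) * ?y $ j * (?x' $ i - ?x $ i)) - (\<Sum>i<n. z' $ i * ?y $ i * (?x' $ i - ?x $ i))"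
    by (simp add: sum_subtractf sum_distrib_right)
  also have "(\<Sum>i<n. \<Sum>j<n. A $$ (j, i) * ?y $ j * (?x' $ i - ?x $ i)) =
      (\<Sum>j<n. ?y $ j * ((\<Sum>i<n. A $$ (j, i) * ?x' $ i) - (\<Sum>i<n. A $$ (j, i) * ?x $ i)))"
    by (subst sum.swap) (simp add: sum_distrib_left sum_subtractf[symmetric] algebra_simps)
  \<comment> \<open>The right-hand side \<open>b\<close> is common to both systems and
    cancels.\<close>
  also have "\<dots> = (\<Sum>j<n. ?y $ j * (z' $ j * ?x' $ j - z $ j * ?x $ j))"
    using x_vec_index[OF z] x_vec_index[OF z'] by (intro sum.cong) auto
  also have "\<dots> - (\<Sum>i<n. z' $ i * ?y $ i * (?x' $ i - ?x $ i)) = (\<Sum>i<n. (z' $ i - z $ i) * ?x $ i * ?y $ i)"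
    unfolding sum_subtractf[symmetric] by (intro sum.cong) (auto simp: algebra_simps)
  moreover have "potential z' - potential z =
      (\<Sum>i<n. (z' $ i - z $ i) * ?x $ i) + (\<Sum>i<n. z' $ i * (?x' $ i - ?x $ i))"
    unfolding potential_def sum_subtractf[symmetric] sum.distrib[symmetric]
    by (intro sum.cong) (auto simp: algebra_simps)
  ultimately show ?thesis by (simp add: sum.distrib distrib_left)
qed

lemma sign_vec_flip: "sign_vec n z \<Longrightarrow> sign_vec n (flip S z)"
  unfolding sign_vec_def flip_def by force

lemma mismatch_subset: "sign_vec n z \<Longrightarrow> mismatch A b z \<subseteq> {..<n}"
  by (auto simp: mismatch_def dest: sign_vec_carrier)

lemma finite_mismatch: "sign_vec n z \<Longrightarrow> finite (mismatch A b z)"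
  using mismatch_subset finite_subset by blast

lemma mismatch_abs:
  assumes z: "sign_vec n z" and i: "i \<in> mismatch A b z"
  shows "- (z $ i * x_vec A b z $ i) = \<bar>x_vec A b z $ i\<bar>" "0 < \<bar>x_vec A b z $ i\<bar>"
  using i sign_vec_cases[OF z, of i] sign_vec_carrier[OF z] by (auto simp: mismatch_def)

text \<open>Only flipped coordinates contribute; there \<open>z'\<close> minus \<open>z\<close> is
  \<open>- 2 z\<close>, and a mismatch turns \<open>- 2 z x\<close> into
  \<open>2 \<bar>x\<bar>\<close>.\<close>

lemma potential_flip:
  assumes z: "sign_vec n z" and S: "S \<subseteq> mismatch A b z"
  shows "potential (flip S z) - potential z =
    (\<Sum>i\<in>S. 2 * \<bar>x_vec A b z $ i\<bar> * (1 + y_vec A (flip S z) $ i))"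
proof -
  have Sn: "S \<subseteq> {..<n}" using S mismatch_subset[OF z] by blast
  have "potential (flip S z) - potential z =
      (\<Sum>i<n. if i \<in> S then 2 * \<bar>x_vec A b z $ i\<bar> * (1 + y_vec A (flip S z) $ i) else 0)"
    unfolding potential_diff[OF z sign_vec_flip[OF z]]
  proof (intro sum.cong refl)
    fix i assume i: "i \<in> {..<n}"
    show "(flip S z $ i - z $ i) * x_vec A b z $ i * (1 + y_vec A (flip S z) $ i) =
      (if i \<in> S then 2 * \<bar>x_vec A b z $ i\<bar> * (1 + y_vec A (flip S z) $ i) else 0)"
    proof (cases "i \<in> S")
      case True
      then have "\<bar>x_vec A b z $ i\<bar> = - (z $ i * x_vec A b z $ i)" using mismatch_abs(1)[OF z] S by auto
      then show ?thesis using i True sign_vec_carrier[OF z] by (simp add: flip_def)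
    qed (use i sign_vec_carrier[OF z] in \<open>simp add: flip_def\<close>)
  qed
  also have "\<dots> = (\<Sum>i\<in>S. 2 * \<bar>x_vec A b z $ i\<bar> * (1 + y_vec A (flip S z) $ i))"
    using Sn by (subst sum.inter_restrict[symmetric]) (auto simp: Int_absorb1)
  finally show ?thesis .
qed

lemma potential_flip_ge:
  assumes z: "sign_vec n z" and S: "S \<subseteq> mismatch A b z"
  shows "2 * ((1 - 2 * r) / (1 - r)) * (\<Sum>i\<in>S. \<bar>x_vec A b z $ i\<bar>) \<le> potential (flip S z) - potential z"
  unfolding potential_flip[OF assms] sum_distrib_left
proof (rule sum_mono)
  fix i assume "i \<in> S"
  then have "i < n" using S mismatch_subset[OF z] by auto
  from mult_left_mono[OF one_plus_y_vec(1)[OF sign_vec_flip[OF z, of S] this], of "2 * \<bar>x_vec A b z $ i\<bar>"]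
  show "2 * ((1 - 2 * r) / (1 - r)) * \<bar>x_vec A b z $ i\<bar> \<le> 2 * \<bar>x_vec A b z $ i\<bar> * (1 + y_vec A (flip S z) $ i)"
    by (simp only: mult_ac)
qed

lemma potential_flip_less:
  assumes z: "sign_vec n z" and S: "S \<subseteq> mismatch A b z" "S \<noteq> {}"
  shows "potential z < potential (flip S z)"
proof -
  have "finite S" using finite_subset[OF S(1) finite_mismatch[OF z]] .
  then have "0 < (\<Sum>i\<in>S. \<bar>x_vec A b z $ i\<bar>)"
    using S mismatch_abs(2)[OF z] by (intro sum_pos) auto
  then have "0 < 2 * ((1 - 2 * r) / (1 - r)) * (\<Sum>i\<in>S. \<bar>x_vec A b z $ i\<bar>)"
    using r_half by simp
  then show ?thesis using potential_flip_ge[OF z S(1)] by linarith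
qed

text \<open>Off the mismatch set \<open>z\<close> already agrees in sign with \<open>x\<close>, so
  changing it contributes nothing positive; on the set the contribution is at most
  \<open>2 \<bar>x\<bar>\<close> times the upper bound for \<open>1 + y'\<close>. Against a
  maximizer \<open>z'\<close> this bounds the remaining gap by the same sum that
  \<open>potential_flip_ge\<close> uses from below, the ratio of the constants being
  \<open>1 - 2 * r\<close>.\<close>

lemma potential_gap_le:
  assumes z: "sign_vec n z" and z': "sign_vec n z'"
  shows "potential z' - potential z \<le> 2 / (1 - r) * (\<Sum>i\<in>mismatch A b z. \<bar>x_vec A b z $ i\<bar>)"
proof -
  have "potential z' - potential z \<le>
      (\<Sum>i<n. if i \<in> mismatch A b z then 2 / (1 - r) * \<bar>x_vec A b z $ i\<bar> else 0)"
    unfolding potential_diff[OF z z']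
  proof (rule sum_mono)
    fix i assume i: "i \<in> {..<n}"
    let ?x = "x_vec A b z $ i" and ?y = "1 + y_vec A z' $ i"
    have y: "0 < ?y" "?y \<le> 1 / (1 - r)" using one_plus_y_vec[OF z'] i by auto
    show "(z' $ i - z $ i) * ?x * ?y \<le> (if i \<in> mismatch A b z then 2 / (1 - r) * \<bar>?x\<bar> else 0)"
    proof (cases "i \<in> mismatch A b z")
      case True
      have "(z' $ i - z $ i) * ?x \<le> 2 * \<bar>?x\<bar>"
        using sign_vec_cases[OF z, of i] sign_vec_cases[OF z', of i] i by (auto simp: abs_if)
      then have "(z' $ i - z $ i) * ?x * ?y \<le> 2 * \<bar>?x\<bar> * ?y"
        using y by (intro mult_right_mono) auto
      also have "\<dots> \<le> 2 * \<bar>?x\<bar> * (1 / (1 - r))" using y by (intro mult_left_mono) auto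
      finally show ?thesis using True by simp
    next
      case False
      then have "0 \<le> z $ i * ?x" using i sign_vec_carrier[OF z] by (auto simp: mismatch_def)
      then have "(z' $ i - z $ i) * ?x \<le> 0"
        using sign_vec_cases[OF z, of i] sign_vec_cases[OF z', of i] i by auto
      then show ?thesis using y False by (simp add: mult_le_0_iff)
    qed
  qed
  also have "\<dots> = 2 / (1 - r) * (\<Sum>i\<in>mismatch A b z. \<bar>x_vec A b z $ i\<bar>)"
    using mismatch_subset[OF z] unfolding sum_distrib_left
    by (subst sum.inter_restrict[symmetric]) (auto simp: Int_absorb1)
  finally show ?thesis .
qed

section \<open>Runs of the algorithm and the unique solution\<close>

lemma sign_vec_step: "sign_vec n z \<Longrightarrow> sign_flip_step A b R z z' \<Longrightarrow> sign_vec n z'"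
  by (auto simp: sign_flip_step_def sign_vec_flip)

lemma sign_vec_run:
  assumes "sign_flip_run A b R zs T" "k \<le> T"
  shows "sign_vec n (zs k)"
  using assms(2)
proof (induction k)
  case 0
  then show ?case using assms(1) b by (simp add: sign_flip_run_def)
next
  case (Suc k)
  then have "sign_flip_step A b R (zs k) (zs (Suc k))" using assms(1) by (simp add: sign_flip_run_def)
  then show ?case using Suc sign_vec_step by simp
qed

lemma potential_step_less:
  "sign_vec n z \<Longrightarrow> sign_flip_step A b R z z' \<Longrightarrow> potential z < potential z'"
  unfolding sign_flip_step_def using potential_flip_less by blast

text \<open>Without mismatches \<open>Z x\<close> is the entrywise absolute value of
  \<open>x\<close>, so the linear system becomes the absolute value equation.\<close>

lemma ave_solution_x_vec:
  assumes z: "sign_vec n z" and m: "mismatch A b z = {}"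
  shows "ave_solution A b (x_vec A b z)"
proof -
  let ?x = "x_vec A b z"
  note xc = x_vec_carrier[OF z]
  have "A *\<^sub>v ?x - abs_vec ?x = b"
  proof (rule eq_vecI)
    fix i assume "i < dim_vec b"
    then have i: "i < n" using b by simp
    have "0 \<le> z $ i * ?x $ i" using m i sign_vec_carrier[OF z] by (force simp: mismatch_def)
    then have "\<bar>?x $ i\<bar> = z $ i * ?x $ i" using sign_vec_cases[OF z i] by auto
    then show "(A *\<^sub>v ?x - abs_vec ?x) $ i = b $ i"
      using x_vec_index[OF z i] index_mult_mat_vec_sum[OF A xc i] A xc i
      by (simp del: index_mult_mat_vec)
  qed (use b xc in auto)
  then show ?thesis using b xc by (simp add: ave_solution_def)
qed

lemma ave_solution_unique:
  assumes u: "ave_solution A b u" and v: "ave_solution A b v"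
  shows "u = v"
proof -
  have uc: "u \<in> carrier_vec n" and vc: "v \<in> carrier_vec n" using u v b by (auto simp: ave_solution_def)
  show ?thesis
  proof (rule ave_contraction[OF uc vc])
    fix i assume i: "i < n"
    have "(A *\<^sub>v w) $ i = b $ i + \<bar>w $ i\<bar>" if "ave_solution A b w" for w
    proof -
      have "(A *\<^sub>v w - abs_vec w) $ i = b $ i" "w \<in> carrier_vec n" using that b by (auto simp: ave_solution_def)
      then show ?thesis using i A by (simp del: index_mult_mat_vec)
    qed
    note this[OF u] this[OF v]
    moreover have "A *\<^sub>v (u - v) = A *\<^sub>v u - A *\<^sub>v v" using A uc vc by (rule mult_minus_distrib_mat_vec)
    ultimately have "(A *\<^sub>v (u - v)) $ i = \<bar>u $ i\<bar> - \<bar>v $ i\<bar>"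
      using i A by (simp del: index_mult_mat_vec)
    then show "\<bar>(A *\<^sub>v (u - v)) $ i\<bar> \<le> \<bar>u $ i - v $ i\<bar>" by (simp del: index_mult_mat_vec)
  qed
qed

text \<open>There are finitely many sign vectors, so a maximizer exists; it has no mismatch, since
  flipping all mismatches would raise the potential. This is also the source of the existence of a
  solution.\<close>

lemma potential_max:
  obtains zm where "sign_vec n zm" "\<And>z. sign_vec n z \<Longrightarrow> potential z \<le> potential zm"
    "mismatch A b zm = {}"
proof -
  have ne: "sign_vec n (vec n (\<lambda>_. 1))" by (simp add: sign_vec_def)
  define P where "P = potential ` {z. sign_vec n z}"
  have P: "finite P" "P \<noteq> {}" using finite_sign_vec ne by (auto simp: P_def)
  obtain zm where zm: "sign_vec n zm" "potential zm = Max P"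
    using Max_in[OF P] by (auto simp: P_def)
  have max: "potential z \<le> potential zm" if "sign_vec n z" for z
    unfolding zm(2) using that by (intro Max_ge[OF P(1)]) (auto simp: P_def)
  have "mismatch A b zm = {}"
  proof (rule ccontr)
    assume "mismatch A b zm \<noteq> {}"
    from potential_flip_less[OF zm(1) order_refl this] max[OF sign_vec_flip[OF zm(1)]]
    show False by (simp add: leD)
  qed
  then show ?thesis using that zm max by blast
qed

text \<open>Along an infinite run the potential would increase strictly, making all its sign vectors
  distinct, although there are only finitely many.\<close>

lemma finds_unique_solution: "sign_flip_finds_unique_solution A b"
  unfolding sign_flip_finds_unique_solution_def
proof (intro conjI allI impI)
  show "\<exists>!x. ave_solution A b x"
    using potential_max ave_solution_x_vec ave_solution_unique by metis
  show "\<nexists>zs. \<forall>T. sign_flip_run A b any_rule zs T"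
  proof
    assume "\<exists>zs. \<forall>T. sign_flip_run A b any_rule zs T"
    then obtain zs where run: "\<And>T. sign_flip_run A b any_rule zs T" by blast
    have sv: "sign_vec n (zs k)" for k using sign_vec_run[OF run[of k]] by simp
    have "strict_mono (\<lambda>k. potential (zs k))"
      unfolding strict_mono_Suc_iff
    proof
      fix k
      have "sign_flip_step A b any_rule (zs k) (zs (Suc k))"
        using run[of "Suc k"] by (simp add: sign_flip_run_def)
      then show "potential (zs k) < potential (zs (Suc k))" by (rule potential_step_less[OF sv])
    qed
    then have "inj zs" by (intro injI) (metis strict_mono_eq)
    moreover have "finite (range zs)" using sv by (intro finite_subset[OF _ finite_sign_vec]) auto
    ultimately show False using finite_imageD by blast
  qed
next
  fix zs T assume "sign_flip_run A b any_rule zs T \<and> mismatch A b (zs T) = {}"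
  then show "ave_solution A b (x_vec A b (zs T))"
    using ave_solution_x_vec sign_vec_run by blast
qed (use b invertible_sub_Diag in auto)

section \<open>Progress guaranteed by the selection rules\<close>

text \<open>Measured by the gain in potential rather than by the captured mismatch, so that it also
  fits the steepest rule, which may choose an index whose mismatch is not the largest.\<close>

definition progress :: "selection_rule \<Rightarrow> real \<Rightarrow> bool" where
  "progress R c \<longleftrightarrow> (\<forall>z z'. sign_vec n z \<longrightarrow> sign_flip_step A b R z z' \<longrightarrow>
     2 * ((1 - 2 * r) / (1 - r)) * (c * (\<Sum>i\<in>mismatch A b z. \<bar>x_vec A b z $ i\<bar>)) \<le> potential z' - potential z)"

lemma progress_capture: "progress (capture_rule c) c"
  unfolding progress_def
proof (intro allI impI)
  fix z z' assume z: "sign_vec n z" and "sign_flip_step A b (capture_rule c) z z'"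
  then obtain S where S: "S \<subseteq> mismatch A b z" "z' = flip S z"
    and cap: "c * (\<Sum>i\<in>mismatch A b z. \<bar>x_vec A b z $ i\<bar>) \<le> (\<Sum>i\<in>S. \<bar>x_vec A b z $ i\<bar>)"
    by (auto simp: sign_flip_step_def capture_rule_def)
  have "2 * ((1 - 2 * r) / (1 - r)) * (c * (\<Sum>i\<in>mismatch A b z. \<bar>x_vec A b z $ i\<bar>))
    \<le> 2 * ((1 - 2 * r) / (1 - r)) * (\<Sum>i\<in>S. \<bar>x_vec A b z $ i\<bar>)"
    using r_half by (intro mult_left_mono cap) simp
  also have "\<dots> \<le> potential z' - potential z" unfolding S(2) by (rule potential_flip_ge[OF z S(1)])
  finally show "2 * ((1 - 2 * r) / (1 - r)) * (c * (\<Sum>i\<in>mismatch A b z. \<bar>x_vec A b z $ i\<bar>))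
    \<le> potential z' - potential z" .
qed

lemma progress_mono:
  assumes "progress R c"
    and "\<And>z S. sign_vec n z \<Longrightarrow> S \<noteq> {} \<Longrightarrow> S \<subseteq> mismatch A b z \<Longrightarrow> R' A b z S \<Longrightarrow> R A b z S"
  shows "progress R' c"
  using assms unfolding progress_def sign_flip_step_def by blast

lemma progress_full: "progress full_flip_rule 1"
  by (rule progress_mono[OF progress_capture]) (simp add: full_flip_rule_def capture_rule_def)

text \<open>The largest of at most \<open>n\<close> terms is at least their sum divided by
  \<open>n\<close>.\<close>

lemma sum_mismatch_le:
  assumes z: "sign_vec n z" and k: "is_arg_max (\<lambda>i. \<bar>x_vec A b z $ i\<bar>) (\<lambda>i. i \<in> mismatch A b z) k"
  shows "1 / real n * (\<Sum>i\<in>mismatch A b z. \<bar>x_vec A b z $ i\<bar>) \<le> \<bar>x_vec A b z $ k\<bar>"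
proof -
  let ?V = "mismatch A b z"
  have kV: "k \<in> ?V" and max: "\<And>i. i \<in> ?V \<Longrightarrow> \<bar>x_vec A b z $ i\<bar> \<le> \<bar>x_vec A b z $ k\<bar>"
    using k by (auto simp: is_arg_max_linorder)
  have "(\<Sum>i\<in>?V. \<bar>x_vec A b z $ i\<bar>) \<le> real (card ?V) * \<bar>x_vec A b z $ k\<bar>"
    by (intro sum_bounded_above max)
  also have "card ?V \<le> n" using card_mono[OF _ mismatch_subset[OF z]] by simp
  then have "real (card ?V) * \<bar>x_vec A b z $ k\<bar> \<le> real n * \<bar>x_vec A b z $ k\<bar>"
    by (intro mult_right_mono) auto
  finally show ?thesis using kV mismatch_subset[OF z] by (auto simp: field_simps)
qed

lemma progress_gauss_southwell: "progress gauss_southwell_rule (1 / real n)"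
  by (rule progress_mono[OF progress_capture])
    (auto simp: gauss_southwell_rule_def capture_rule_def dest: sum_mismatch_le)

text \<open>
  Subtracting the systems that define \<open>y\<close> at \<open>z\<close> and at \<open>flip {k} z\<close> gives
  \<open>(1 + y'\<^sub>k) (1 + 2 z\<^sub>k H\<^sub>k\<^sub>k) = 1 + y\<^sub>k\<close>; this replaces the Sherman-Morrison formula.
\<close>

lemma flip_gain:
  assumes z: "sign_vec n z" and k: "k \<in> mismatch A b z"
  shows "flip_gain A b z k = potential (flip {k} z) - potential z"
proof -
  let ?z' = "flip {k} z" and ?H = "H_mat A z"
  let ?y = "y_vec A z" and ?y' = "y_vec A ?z'"
  have kn: "k < n" using k mismatch_subset[OF z] by auto
  note z' = sign_vec_flip[OF z, of "{k}"] and zc = sign_vec_carrier[OF z] and yc = y_vec_carrier[OF z]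
  note y'c = y_vec_carrier[OF z']
  \<comment> \<open>This is the transposed matrix \<open>A - Z\<close> at the old signs, applied to
    the new \<open>?y'\<close>; it differs from \<open>z\<close> only in coordinate
    \<open>k\<close>, where the sign has changed.\<close>
  have col: "(\<Sum>i<n. (A $$ (i, j) - (if i = j then z $ j else 0)) * ?y' $ i) =
      z $ j - (if j = k then 2 * z $ k * (1 + ?y' $ k) else 0)" if j: "j < n" for j
  proof -
    have "(\<Sum>i<n. (A $$ (i, j) - (if i = j then z $ j else 0)) * ?y' $ i) =
        (\<Sum>i<n. A $$ (i, j) * ?y' $ i) - (\<Sum>i<n. (if j = i then z $ i else 0) * ?y' $ i)"
      unfolding sum_subtractf[symmetric] by (intro sum.cong) (auto simp: left_diff_distrib)
    then show ?thesis
      using y_vec_index[OF z' j] zc j by (auto simp: sum_of_bool_mult_index flip_def algebra_simps)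
  qed
  have ent: "(\<Sum>j<n. (A $$ (i, j) - (if i = j then z $ j else 0)) * ?H $$ (j, k)) = (if k = i then 1 else 0)"
    if i: "i < n" for i
  proof -
    have "((A - Diag z) * ?H) $$ (i, k) = (\<Sum>j<n. (A $$ (i, j) - (if i = j then z $ j else 0)) * ?H $$ (j, k))"
      using i kn A zc H_mat(1)[OF z] by (auto simp: scalar_prod_def lessThan_atLeast0 intro!: sum.cong)
    then show ?thesis using H_mat(2)[OF z] i kn by auto
  qed
  \<comment> \<open>Column \<open>k\<close> of the identity is inserted as column \<open>k\<close>
    of \<open>(A - Z) ?H\<close>, which turns the entry of \<open>?y'\<close> into a pairing of that
    column of \<open>?H\<close> with the vector from \<open>col\<close>.\<close>
  have "?y' $ k = (\<Sum>i<n. (if k = i then 1 else 0) * ?y' $ i)"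
    using sum_of_bool_mult_index[OF kn, of "\<lambda>_. 1" "\<lambda>i. ?y' $ i"] by simp
  also have "\<dots> = (\<Sum>i<n. (\<Sum>j<n. (A $$ (i, j) - (if i = j then z $ j else 0)) * ?H $$ (j, k)) * ?y' $ i)"
    by (intro sum.cong) (auto simp: ent)
  also have "\<dots> = (\<Sum>j<n. ?H $$ (j, k) * (\<Sum>i<n. (A $$ (i, j) - (if i = j then z $ j else 0)) * ?y' $ i))"
    unfolding sum_distrib_right sum_distrib_left by (subst sum.swap) (simp add: mult_ac)
  also have "\<dots> = (\<Sum>j<n. ?H $$ (j, k) * z $ j - (if k = j then 2 * z $ k * (1 + ?y' $ k) else 0) * ?H $$ (j, k))"
    by (intro sum.cong) (auto simp: col right_diff_distrib)
  also have "\<dots> = (\<Sum>j<n. ?H $$ (j, k) * z $ j) - 2 * z $ k * (1 + ?y' $ k) * ?H $$ (k, k)"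
    using kn by (simp add: sum_subtractf sum_of_bool_mult_index)
  also have "(\<Sum>j<n. ?H $$ (j, k) * z $ j) = ?y $ k"
    using index_mult_mat_vec_sum[of "transpose_mat ?H" n n z k] H_mat(1)[OF z] zc kn by (simp add: y_vec_def)
  finally have *: "(1 + ?y' $ k) * (1 + 2 * z $ k * ?H $$ (k, k)) = 1 + ?y $ k"
    by (simp add: algebra_simps)
  \<comment> \<open>The product in \<open>*\<close> is positive, so the denominator of
    \<open>flip_gain\<close> cannot vanish.\<close>
  then have "1 + 2 * z $ k * ?H $$ (k, k) \<noteq> 0" using one_plus_y_vec(3)[OF z kn] by auto
  then have "(1 + ?y $ k) / (1 + 2 * z $ k * ?H $$ (k, k)) = 1 + ?y' $ k" by (simp flip: *)
  moreover have "potential ?z' - potential z = 2 * (- (z $ k * x_vec A b z $ k)) * (1 + ?y' $ k)"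
    using potential_flip[OF z, of "{k}"] k mismatch_abs(1)[OF z k] by simp
  ultimately show ?thesis unfolding flip_gain_def by (metis mult_minus_right mult_minus_left times_divide_eq_right mult.assoc)
qed

text \<open>The chosen index gains at least as much as the Gauss-Southwell index \<open>m\<close>
  would, and flipping \<open>m\<close> alone already gains the required amount.\<close>

lemma progress_steepest: "progress steepest_rule (1 / real n)"
  unfolding progress_def
proof (intro allI impI)
  fix z z' assume z: "sign_vec n z" and "sign_flip_step A b steepest_rule z z'"
  then obtain k where k: "is_arg_max (flip_gain A b z) (\<lambda>i. i \<in> mismatch A b z) k" "z' = flip {k} z"
    by (auto simp: sign_flip_step_def steepest_rule_def)
  let ?V = "mismatch A b z"
  have kV: "k \<in> ?V" and max: "\<And>i. i \<in> ?V \<Longrightarrow> flip_gain A b z i \<le> flip_gain A b z k"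
    using k(1) by (auto simp: is_arg_max_linorder)
  obtain m where m: "is_arg_max (\<lambda>i. \<bar>x_vec A b z $ i\<bar>) (\<lambda>i. i \<in> ?V) m"
  proof -
    have "Max ((\<lambda>i. \<bar>x_vec A b z $ i\<bar>) ` ?V) \<in> (\<lambda>i. \<bar>x_vec A b z $ i\<bar>) ` ?V"
      using finite_mismatch[OF z] kV by (intro Max_in) auto
    then obtain m where "m \<in> ?V" "\<bar>x_vec A b z $ m\<bar> = Max ((\<lambda>i. \<bar>x_vec A b z $ i\<bar>) ` ?V)" by auto
    then have "is_arg_max (\<lambda>i. \<bar>x_vec A b z $ i\<bar>) (\<lambda>i. i \<in> ?V) m"
      using finite_mismatch[OF z] by (auto simp: is_arg_max_linorder)
    then show ?thesis using that by blast
  qed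
  then have mV: "m \<in> ?V" by (simp add: is_arg_max_def)
  have "2 * ((1 - 2 * r) / (1 - r)) * (1 / real n * (\<Sum>i\<in>?V. \<bar>x_vec A b z $ i\<bar>))
    \<le> 2 * ((1 - 2 * r) / (1 - r)) * \<bar>x_vec A b z $ m\<bar>"
    using r_half by (intro mult_left_mono sum_mismatch_le[OF z m]) simp
  also have "\<dots> \<le> potential (flip {m} z) - potential z"
    using potential_flip_ge[OF z, of "{m}"] mV by simp
  also have "\<dots> \<le> potential z' - potential z"
    using max[OF mV] flip_gain[OF z mV] flip_gain[OF z kV] k(2) by simp
  finally show "2 * ((1 - 2 * r) / (1 - r)) * (1 / real n * (\<Sum>i\<in>?V. \<bar>x_vec A b z $ i\<bar>))
    \<le> potential z' - potential z" .
qed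

text \<open>After \<open>T\<close> iterations the gap to the maximum is at most \<open>2 * G\<close>
  times a decaying exponential. Since one more iteration still raises the potential, that gap is at
  least \<open>1 / Q\<close>; comparing the two bounds \<open>T\<close>.\<close>

lemma iterations_bound:
  assumes prog: "progress R c" and c: "0 < c" "c \<le> 1"
    and G: "\<And>z. sign_vec n z \<Longrightarrow> \<bar>potential z\<bar> \<le> G"
    and Q: "0 < Q" "\<And>z z'. sign_vec n z \<Longrightarrow> sign_vec n z' \<Longrightarrow> potential z < potential z' \<Longrightarrow> 1 \<le> Q * (potential z' - potential z)"
    and run: "sign_flip_run A b R zs (Suc T)"
  shows "real T * (c * (1 - 2 * r)) \<le> ln (2 * G * Q)"
proof -
  obtain zm where zm: "sign_vec n zm" "\<And>z. sign_vec n z \<Longrightarrow> potential z \<le> potential zm"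
    using potential_max by metis
  define g where "g k = potential zm - potential (zs k)" for k
  let ?\<kappa> = "c * (1 - 2 * r)"
  have sv: "sign_vec n (zs k)" if "k \<le> Suc T" for k using sign_vec_run[OF run that] .
  have step: "g (Suc k) \<le> exp (- ?\<kappa>) * g k" if k: "k < Suc T" for k
  proof -
    let ?V = "\<Sum>i\<in>mismatch A b (zs k). \<bar>x_vec A b (zs k) $ i\<bar>"
    have svk: "sign_vec n (zs k)" using sv k by simp
    have "2 * ((1 - 2 * r) / (1 - r)) * (c * ?V) \<le> potential (zs (Suc k)) - potential (zs k)"
      using prog svk run k unfolding progress_def sign_flip_run_def by blast
    moreover have "?\<kappa> * g k \<le> ?\<kappa> * (2 / (1 - r) * ?V)"
      unfolding g_def using c r_half by (intro mult_left_mono potential_gap_le[OF svk zm(1)]) auto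
    \<comment> \<open>The guaranteed gain and the upper bound for \<open>?\<kappa> * g k\<close> are
      the same multiple of \<open>?V\<close>, so one iteration gains at least
      \<open>?\<kappa> * g k\<close>.\<close>
    ultimately have "g (Suc k) \<le> (1 + - ?\<kappa>) * g k" by (simp add: g_def algebra_simps)
    also have "\<dots> \<le> exp (- ?\<kappa>) * g k"
      using zm(2)[OF svk] by (intro mult_right_mono exp_ge_add_one_self) (simp add: g_def)
    finally show ?thesis .
  qed
  have "k \<le> T \<Longrightarrow> g k \<le> exp (- ?\<kappa>) ^ k * g 0" for k
  proof (induction k)
    case (Suc k)
    have "g (Suc k) \<le> exp (- ?\<kappa>) * g k" using Suc.prems by (intro step) simp
    also have "\<dots> \<le> exp (- ?\<kappa>) * (exp (- ?\<kappa>) ^ k * g 0)" using Suc by (intro mult_left_mono) auto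
    finally show ?case by (simp add: mult_ac)
  qed simp
  then have "g T \<le> exp (- (real T * ?\<kappa>)) * g 0" by (simp flip: exp_of_nat_mult)
  moreover have "g 0 \<le> 2 * G" using G[OF zm(1)] G[OF sv[of 0]] by (simp add: g_def)
  ultimately have gT: "g T \<le> exp (- (real T * ?\<kappa>)) * (2 * G)"
    by (meson exp_ge_zero mult_left_mono order_trans)
  have "sign_flip_step A b R (zs T) (zs (Suc T))" using run by (simp add: sign_flip_run_def)
  then have less: "potential (zs T) < potential (zs (Suc T))" using potential_step_less sv by simp
  have "1 \<le> Q * (potential (zs (Suc T)) - potential (zs T))" using less sv by (intro Q(2)) auto
  also have "\<dots> \<le> Q * g T" using zm(2)[OF sv[of "Suc T"]] Q(1) by (intro mult_left_mono) (auto simp: g_def)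
  also have "\<dots> \<le> Q * (exp (- (real T * ?\<kappa>)) * (2 * G))" using gT Q(1) by (intro mult_left_mono) auto
  finally have "exp (real T * ?\<kappa>) * 1 \<le> exp (real T * ?\<kappa>) * (Q * (exp (- (real T * ?\<kappa>)) * (2 * G)))"
    by (intro mult_left_mono) auto
  also have "\<dots> = 2 * G * Q * (exp (real T * ?\<kappa>) * exp (- (real T * ?\<kappa>)))"
    by (simp only: mult_ac)
  finally have "exp (real T * ?\<kappa>) \<le> 2 * G * Q" by (simp only: exp_minus_inverse mult_1_right)
  moreover from this have "0 < 2 * G * Q" using exp_gt_zero less_le_trans by blast
  ultimately show ?thesis by (simp add: ln_ge_iff)
qed

end

section \<open>The diagonal preconditioner\<close>

lemma weight_system_index:
  assumes B: "B \<in> carrier_mat n n" and v: "v \<in> carrier_vec n" and j: "j < n"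
  shows "((\<rho> \<cdot>\<^sub>m 1\<^sub>m n - transpose_mat B) *\<^sub>v v) $ j = \<rho> * v $ j - (\<Sum>i<n. B $$ (i, j) * (v $ i :: real))"
proof -
  have "((\<rho> \<cdot>\<^sub>m 1\<^sub>m n - transpose_mat B) *\<^sub>v v) $ j =
      (\<Sum>i<n. (if j = i then \<rho> else 0) * v $ i - B $$ (i, j) * v $ i)"
    using assms by (subst index_mult_mat_vec_sum[of _ n n]) (auto simp: minus_carrier_mat left_diff_distrib intro!: sum.cong)
  then show ?thesis using j by (simp add: sum_subtractf sum_of_bool_mult_index)
qed

text \<open>For a kernel vector the hypothesis of \<open>nonneg_of_spectral_radius_less\<close>
  holds with equality, hence for \<open>v\<close> and for \<open>- v\<close>, and both are
  nonnegative.\<close>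

lemma weight_matrix_invertible:
  assumes B: "B \<in> carrier_mat n n" and nonneg: "\<And>i j. i < n \<Longrightarrow> j < n \<Longrightarrow> 0 \<le> B $$ (i, j)"
    and \<rho>: "real_spectral_radius B < \<rho>"
  shows "invertible_mat (\<rho> \<cdot>\<^sub>m 1\<^sub>m n - transpose_mat B)"
proof (rule invertible_matI_kernel)
  show "\<rho> \<cdot>\<^sub>m 1\<^sub>m n - transpose_mat B \<in> carrier_mat n n" using B by (simp add: minus_carrier_mat)
  fix v assume v: "v \<in> carrier_vec n" and 0: "(\<rho> \<cdot>\<^sub>m 1\<^sub>m n - transpose_mat B) *\<^sub>v v = 0\<^sub>v n"
  have eq: "(\<Sum>i<n. B $$ (i, j) * v $ i) = \<rho> * v $ j" if "j < n" for j
    using weight_system_index[OF B v that, of \<rho>] 0 that by simp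
  show "v = 0\<^sub>v n"
  proof (rule eq_vecI)
    fix k assume "k < dim_vec (0\<^sub>v n :: real vec)"
    then have k: "k < n" by simp
    have "0 \<le> v $ k" using eq by (intro nonneg_of_spectral_radius_less[OF B nonneg \<rho> v _ k]) auto
    moreover have "0 \<le> (- v) $ k"
    proof (rule nonneg_of_spectral_radius_less[OF B nonneg \<rho> _ _ k])
      fix j assume j: "j < n"
      have "(\<Sum>i<n. B $$ (i, j) * (- v) $ i) = - (\<Sum>i<n. B $$ (i, j) * v $ i)"
        unfolding sum_negf[symmetric] using v by (intro sum.cong) auto
      then show "(\<Sum>i<n. B $$ (i, j) * (- v) $ i) \<le> \<rho> * (- v) $ j" using eq[OF j] v j by simp
    qed (use v in auto)
    ultimately show "v $ k = 0\<^sub>v n $ k" using v k by simp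
  qed (use v in simp)
qed

lemma weight_exists1:
  assumes "B \<in> carrier_mat n n" "\<And>i j. i < n \<Longrightarrow> j < n \<Longrightarrow> 0 \<le> B $$ (i, j)"
    "real_spectral_radius B < \<rho>"
  shows "\<exists>!w. w \<in> carrier_vec n \<and> (\<rho> \<cdot>\<^sub>m 1\<^sub>m n - transpose_mat B) *\<^sub>v w = vec n (\<lambda>_. 1)"
proof -
  define M where "M = \<rho> \<cdot>\<^sub>m 1\<^sub>m n - transpose_mat B"
  have M: "M \<in> carrier_mat n n" using assms(1) by (simp add: M_def minus_carrier_mat)
  have inv: "invertible_mat M" unfolding M_def using assms by (rule weight_matrix_invertible)
  note i = inv_mat[OF M inv]
  let ?e = "vec n (\<lambda>_. 1 :: real)"
  show ?thesis unfolding M_def[symmetric]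
  proof (rule ex1I[of _ "inv_mat M *\<^sub>v ?e"])
    show "inv_mat M *\<^sub>v ?e \<in> carrier_vec n \<and> M *\<^sub>v (inv_mat M *\<^sub>v ?e) = ?e"
      using M i by (auto simp flip: assoc_mult_mat_vec)
    fix w assume w: "w \<in> carrier_vec n \<and> M *\<^sub>v w = ?e"
    then have "inv_mat M *\<^sub>v ?e = (inv_mat M * M) *\<^sub>v w"
      using assoc_mult_mat_vec[OF i(1) M, of w] by simp
    then show "w = inv_mat M *\<^sub>v ?e" using i w by simp
  qed
qed

text \<open>The all-ones right-hand side gives the inequality needed for nonnegativity; putting this
  back into the equation yields \<open>\<rho> * w $ k >= 1\<close>.\<close>

lemma weight_pos:
  assumes B: "B \<in> carrier_mat n n" and nonneg: "\<And>i j. i < n \<Longrightarrow> j < n \<Longrightarrow> 0 \<le> B $$ (i, j)"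
    and \<rho>: "real_spectral_radius B < \<rho>" and w: "w \<in> carrier_vec n"
    and eq: "(\<rho> \<cdot>\<^sub>m 1\<^sub>m n - transpose_mat B) *\<^sub>v w = vec n (\<lambda>_. 1)" and k: "k < n"
  shows "0 < w $ k" "0 < \<rho>"
proof -
  have eq': "\<rho> * w $ j = 1 + (\<Sum>i<n. B $$ (i, j) * w $ i)" if "j < n" for j
    using weight_system_index[OF B w that, of \<rho>] eq that by simp
  have nn: "0 \<le> w $ j" if "j < n" for j
    using eq' by (intro nonneg_of_spectral_radius_less[OF B nonneg \<rho> w _ that]) auto
  have "n > 0" using k by simp
  from spectral_radius_power_bounded[OF B this \<rho>] show "0 < \<rho>" .
  have "0 < \<rho> * w $ k"
    unfolding eq'[OF k] using nonneg nn k by (intro add_pos_nonneg sum_nonneg) auto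
  then show "0 < w $ k" using \<open>0 < \<rho>\<close> by (simp add: zero_less_mult_iff)
qed

section \<open>Conjugation by a diagonal matrix\<close>

text \<open>For weights without zeros this is \<open>Diag w * P * inv_mat (Diag w)\<close>, see
  \<open>Diag_conj\<close>; the entrywise form makes products and column sums directly
  computable.\<close>

definition diag_conj :: "real vec \<Rightarrow> real mat \<Rightarrow> real mat" where
  "diag_conj w P = mat (dim_vec w) (dim_vec w) (\<lambda>(i, j). w $ i * P $$ (i, j) / w $ j)"

lemma diag_conj_carrier: "w \<in> carrier_vec n \<Longrightarrow> diag_conj w P \<in> carrier_mat n n"
  by (simp add: diag_conj_def)

lemma diag_conj_index:
  "w \<in> carrier_vec n \<Longrightarrow> i < n \<Longrightarrow> j < n \<Longrightarrow> diag_conj w P $$ (i, j) = w $ i * P $$ (i, j) / w $ j"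
  by (simp add: diag_conj_def)

lemma diag_conj_mult:
  assumes w: "w \<in> carrier_vec n" and w0: "\<And>i. i < n \<Longrightarrow> w $ i \<noteq> 0"
    and P: "P \<in> carrier_mat n n" and P': "P' \<in> carrier_mat n n"
  shows "diag_conj w P * diag_conj w P' = diag_conj w (P * P')"
proof (rule eq_matI)
  fix i j assume "i < dim_row (diag_conj w (P * P'))" "j < dim_col (diag_conj w (P * P'))"
  then have ij: "i < n" "j < n" using w by (auto simp: diag_conj_def)
  have "(diag_conj w P * diag_conj w P') $$ (i, j) =
      (\<Sum>k<n. w $ i * P $$ (i, k) / w $ k * (w $ k * P' $$ (k, j) / w $ j))"
    using ij w by (auto simp: diag_conj_def scalar_prod_def lessThan_atLeast0 intro!: sum.cong)
  also have "\<dots> = (\<Sum>k<n. w $ i * (P $$ (i, k) * P' $$ (k, j)) / w $ j)"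
    using w0 by (intro sum.cong) auto
  also have "\<dots> = w $ i * (P * P') $$ (i, j) / w $ j"
    using ij P P' by (simp add: scalar_prod_def lessThan_atLeast0 sum_distrib_left sum_divide_distrib)
  finally show "(diag_conj w P * diag_conj w P') $$ (i, j) = diag_conj w (P * P') $$ (i, j)"
    using diag_conj_index[OF w ij] by simp
qed (auto simp: diag_conj_def)

lemma diag_conj_one:
  assumes "w \<in> carrier_vec n" "\<And>i. i < n \<Longrightarrow> w $ i \<noteq> 0"
  shows "diag_conj w (1\<^sub>m n) = 1\<^sub>m n"
  using assms by (intro eq_matI) (auto simp: diag_conj_def)

lemma Diag_conj:
  assumes w: "w \<in> carrier_vec n" and w0: "\<And>i. i < n \<Longrightarrow> w $ i \<noteq> 0" and P: "P \<in> carrier_mat n n"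
  shows "Diag w * P * inv_mat (Diag w) = diag_conj w P"
proof -
  define V where "V = mat_diag n (\<lambda>i. 1 / w $ i)"
  have D: "Diag w = mat_diag n (\<lambda>i. w $ i)" using w by (simp add: Diag_def)
  have *: "Diag w * V = 1\<^sub>m n" "V * Diag w = 1\<^sub>m n" "V \<in> carrier_mat n n"
    unfolding D V_def mat_diag_diag using w0 by (auto simp: mat_diag_def intro!: eq_matI)
  then have "invertible_mat (Diag w)" using w by (intro invertible_matI[of _ n]) auto
  then have inv: "inv_mat (Diag w) = V" using * w by (intro inv_mat_unique[of _ n]) auto
  have "Diag w * P = mat n n (\<lambda>(i, j). w $ i * P $$ (i, j))"
    unfolding D using P by (rule mat_diag_mult_left)
  then show ?thesis
    unfolding inv V_def using w by (subst mat_diag_mult_right[of _ n]) (auto simp: diag_conj_def intro!: eq_matI)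
qed

section \<open>The preconditioned equation\<close>

locale weighted_ave =
  fixes n :: nat and A :: "real mat" and b w :: "real vec" and Abar :: "int mat" and bbar :: "int vec"
    and dA db L p q :: int and \<rho> :: real
  assumes n0: "n > 0"
    and Abar: "Abar \<in> carrier_mat n n" and bbar: "bbar \<in> carrier_vec n"
    and dA: "0 < dA" "dA \<le> L" and db: "0 < db" "db \<le> L"
    and A_eq: "A = (1 / real_of_int dA) \<cdot>\<^sub>m map_mat real_of_int Abar"
    and b_eq: "b = (1 / real_of_int db) \<cdot>\<^sub>v map_vec real_of_int bbar"
    and Abar_le: "\<And>i j. i < n \<Longrightarrow> j < n \<Longrightarrow> \<bar>Abar $$ (i, j)\<bar> \<le> L"
    and bbar_le: "\<And>i. i < n \<Longrightarrow> \<bar>bbar $ i\<bar> \<le> L"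
    and inv: "invertible_mat A"
    and radius: "real_spectral_radius (abs_mat (inv_mat A)) < \<rho>"
    and \<rho>_half: "\<rho> < 1 / 2" and \<rho>_eq: "\<rho> = real_of_int p / real_of_int q" and q: "0 < q"
    and w: "w \<in> carrier_vec n"
    and w_eq: "(\<rho> \<cdot>\<^sub>m 1\<^sub>m n - transpose_mat (abs_mat (inv_mat A))) *\<^sub>v w = vec n (\<lambda>_. 1)"
begin

abbreviation Ai where "Ai \<equiv> inv_mat A"

lemma A_carrier: "A \<in> carrier_mat n n" and b_carrier: "b \<in> carrier_vec n"
  using Abar bbar by (simp_all add: A_eq b_eq)

lemmas inv_A = inv_mat[OF A_carrier inv]

lemma absAi: "abs_mat Ai \<in> carrier_mat n n" "\<And>i j. i < n \<Longrightarrow> j < n \<Longrightarrow> 0 \<le> abs_mat Ai $$ (i, j)"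
  using inv_A(1) by auto

lemma w_pos: "i < n \<Longrightarrow> 0 < w $ i"
  using weight_pos(1)[OF absAi radius w w_eq] .

lemma rho_pos: "0 < \<rho>"
  using weight_pos(2)[OF absAi radius w w_eq n0] .

lemma w_index: "j < n \<Longrightarrow> (\<Sum>i<n. \<bar>Ai $$ (i, j)\<bar> * w $ i) = \<rho> * w $ j - 1"
  using weight_system_index[OF absAi(1) w, of j \<rho>] w_eq inv_A(1) by simp

abbreviation At where "At \<equiv> diag_conj w A"
abbreviation bt where "bt \<equiv> Diag w *\<^sub>v b"

lemma bt: "bt \<in> carrier_vec n" "i < n \<Longrightarrow> bt $ i = w $ i * b $ i"
proof -
  show "bt \<in> carrier_vec n" using mult_mat_vec_carrier[OF Diag_carrier[OF w] b_carrier] .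
  assume i: "i < n"
  have "bt $ i = (\<Sum>j<n. (if i = j then w $ j else 0) * b $ j)"
    using index_mult_mat_vec_sum[of "Diag w" n n b i] w b_carrier i by (simp del: index_mult_mat_vec)
  then show "bt $ i = w $ i * b $ i" using i by (simp add: sum_of_bool_mult_index)
qed

text \<open>By \<open>w_index\<close>, the columns of \<open>\<bar>Ai\<bar>\<close> weighted with
  \<open>w\<close> sum to \<open>\<rho> * w $ j - 1\<close>. Conjugation divides this by
  \<open>w $ j\<close>, so the plain column sums become at most \<open>\<rho>\<close>.\<close>

sublocale contracting_ave n At "diag_conj w Ai" bt \<rho>
proof
  have w0: "w $ i \<noteq> 0" if "i < n" for i using w_pos[OF that] by simp
  show "At * diag_conj w Ai = 1\<^sub>m n" "diag_conj w Ai * At = 1\<^sub>m n"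
    using w w0 A_carrier inv_A by (simp_all add: diag_conj_mult diag_conj_one)
  fix j assume j: "j < n"
  have "(\<Sum>i<n. \<bar>diag_conj w Ai $$ (i, j)\<bar>) = (\<Sum>i<n. \<bar>Ai $$ (i, j)\<bar> * w $ i) / w $ j"
    unfolding sum_divide_distrib using j w w_pos
    by (intro sum.cong) (auto simp: diag_conj_index abs_mult less_imp_le abs_of_pos)
  also have "\<dots> \<le> \<rho>" using w_index[OF j] w_pos[OF j] by (simp add: field_simps)
  finally show "(\<Sum>i<n. \<bar>diag_conj w Ai $$ (i, j)\<bar>) \<le> \<rho>" .
qed (use diag_conj_carrier w bt rho_pos \<rho>_half in auto)

lemma norm1_inv: "norm1_mat (inv_mat At) \<le> \<rho>"
proof -
  have "invertible_mat At"
    using A_Ai Ai_A diag_conj_carrier[OF w] by (intro invertible_matI[of _ n])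
  then have "inv_mat At = diag_conj w Ai"
    using diag_conj_carrier[OF w] Ai_A by (intro inv_mat_unique[of _ n]) auto
  then show ?thesis
    using diag_conj_carrier[OF w, of Ai] col_sum n0 unfolding norm1_mat_def
    by (subst Max_le_iff) auto
qed

section \<open>Sizes of numerators and denominators\<close>

definition N :: int where "N = int n * L"

text \<open>\<open>2 <= N\<close> keeps the logarithm away from zero, so that numerical constants
  can be absorbed into powers of \<open>N\<close> and into the final bound.\<close>

lemma N_ge: "2 \<le> N" "int n \<le> N" "L \<le> N" "1 \<le> L"
proof -
  show L: "1 \<le> L" using dA by simp
  have n1: "1 \<le> int n" using n0 by simp
  show "int n \<le> N" "L \<le> N" using L n1 by (simp_all add: N_def mult_le_cancel_left1 mult_le_cancel_right1)
  show "2 \<le> N"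
  proof (cases "n = 1")
    \<comment> \<open>In dimension one the weight equation forces the inverse below
      \<open>\<rho>\<close>, so the entry of \<open>A\<close> exceeds one in modulus; its numerator
      is then larger than \<open>dA\<close>, hence at least two.\<close>
    case True
    have "A $$ (0, 0) * Ai $$ (0, 0) = 1"
      using arg_cong[OF inv_A(2), of "\<lambda>M. M $$ (0, 0)"] A_carrier inv_A(1) True by (simp add: scalar_prod_def)
    then have prod: "\<bar>A $$ (0, 0)\<bar> * \<bar>Ai $$ (0, 0)\<bar> = 1" by (simp flip: abs_mult)
    have "{..<n} = {0}" using True by auto
    then have "\<bar>Ai $$ (0, 0)\<bar> * w $ 0 < \<rho> * w $ 0" using w_index[of 0] n0 by simp
    then have small: "\<bar>Ai $$ (0, 0)\<bar> < \<rho>" using w_pos[OF n0] by (simp add: mult_less_cancel_right_pos)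
    have "1 < \<bar>A $$ (0, 0)\<bar>"
    proof (rule ccontr)
      assume "\<not> ?thesis"
      then have "\<bar>A $$ (0, 0)\<bar> * \<bar>Ai $$ (0, 0)\<bar> \<le> 1 * \<bar>Ai $$ (0, 0)\<bar>" by (intro mult_right_mono) auto
      then show False using prod small \<rho>_half by simp
    qed
    then have "real_of_int dA < \<bar>real_of_int (Abar $$ (0, 0))\<bar>"
      using Abar dA n0 by (simp add: A_eq abs_mult field_simps)
    then have "dA < \<bar>Abar $$ (0, 0)\<bar>" by linarith
    then show ?thesis unfolding N_def using Abar_le[of 0 0] dA n0 True by simp
  next
    case False
    then have "2 * 1 \<le> int n * L" using n0 L by (intro mult_mono) auto
    then show ?thesis by (simp add: N_def)
  qed
qed

lemma det_Abar: "det Abar \<noteq> 0"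
proof
  assume "det Abar = 0"
  then have "det A = 0"
    using Abar by (simp add: A_eq of_int_hom.hom_det)
  then show False using invertible_mat_det_nonzero[OF A_carrier inv] by simp
qed

text \<open>Column \<open>j\<close> of the inverse solves the integer system with matrix
  \<open>Abar\<close> and right-hand side \<open>dA\<close> times the unit vector \<open>j\<close>,
  to which Cramer's rule applies.\<close>

lemma inverse_integer:
  assumes ij: "i < n" "j < n"
  obtains u :: int where "real_of_int (det Abar) * Ai $$ (i, j) = real_of_int u" "\<bar>u\<bar> \<le> N ^ n"
proof -
  define e where "e = vec n (\<lambda>i. if i = j then dA else 0)"
  have col_j: "col Ai j \<in> carrier_vec n" using col_dim[of Ai j] carrier_matD(1)[OF inv_A(1)] by (simp only:)
  have "map_mat real_of_int Abar *\<^sub>v col Ai j = map_vec real_of_int e"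
  proof (rule eq_vecI)
    fix k assume "k < dim_vec (map_vec real_of_int e)"
    then have k: "k < n" by (simp add: e_def)
    have "(A * Ai) $$ (k, j) = (if k = j then 1 else 0)" using inv_A(2) k ij by simp
    moreover have "(A * Ai) $$ (k, j) = (1 / real_of_int dA) * (map_mat real_of_int Abar *\<^sub>v col Ai j) $ k"
      using k ij Abar inv_A(1) by (simp add: A_eq scalar_prod_def sum_distrib_left mult.assoc)
    ultimately show "(map_mat real_of_int Abar *\<^sub>v col Ai j) $ k = map_vec real_of_int e $ k"
      using k dA(1) by (auto simp: e_def field_simps split: if_splits)
  qed (use Abar in \<open>simp add: e_def\<close>)
  moreover have "\<bar>e $ k\<bar> \<le> L" if "k < n" for k using that dA by (simp add: e_def)
  ultimately obtain u where "real_of_int (det Abar) * col Ai j $ i = real_of_int u" "\<bar>u\<bar> \<le> (int n * L) ^ n"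
    using cramer_int[OF Abar _ col_j _ ij(1) Abar_le, of e] e_def by auto
  moreover have "col Ai j $ i = Ai $$ (i, j)" using ij inv_A(1) by simp
  ultimately show ?thesis using that[of u] unfolding N_def by simp
qed

text \<open>
  \<open>E\<close> bounds the determinants in Cramer's rule for the weights \<open>w\<close>, whose system has entries
  at most \<open>s N\<^sup>n\<close> once multiplied by \<open>q \<bar>det Abar\<bar>\<close>; \<open>F\<close> bounds those for \<open>(Abar - dA Z) (db x) = dA bbar\<close>.
\<close>

definition s :: nat where "s = nat (\<bar>p\<bar> + q)"

definition E :: int where "E = (int n * (int s * N ^ n)) ^ n"
definition F :: int where "F = (int n * (2 * L ^ 2)) ^ n"

text \<open>The inverse has denominator \<open>det Abar\<close>, so scaling the weight system by
  \<open>q * \<bar>det Abar\<bar>\<close> makes it integral. Cramer's rule then gives one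
  denominator \<open>m\<close> for all weights.\<close>

lemma weight_integer:
  obtains m :: int and a :: "nat \<Rightarrow> int" where "m \<noteq> 0" "\<bar>m\<bar> \<le> E"
    "\<And>k. k < n \<Longrightarrow> real_of_int m * w $ k = real_of_int (a k)" "\<And>k. k < n \<Longrightarrow> \<bar>a k\<bar> \<le> E"
proof -
  \<comment> \<open>With the absolute value of the determinant, scaling commutes with taking
    entrywise absolute values of the inverse; see \<open>u_abs\<close>.\<close>
  define D where "D = \<bar>det Abar\<bar>"
  have D: "0 < D" "D \<le> N ^ n"
    using det_Abar abs_det_le[OF Abar Abar_le] by (auto simp: D_def N_def)
  have "\<forall>ij\<in>{..<n} \<times> {..<n}. \<exists>u. real_of_int (det Abar) * Ai $$ ij = real_of_int u \<and> \<bar>u\<bar> \<le> N ^ n"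
    using inverse_integer by (auto, metis)
  from bchoice[OF this] obtain u' where
    u': "\<And>i j. i < n \<Longrightarrow> j < n \<Longrightarrow> real_of_int (det Abar) * Ai $$ (i, j) = real_of_int (u' (i, j)) \<and> \<bar>u' (i, j)\<bar> \<le> N ^ n"
    by auto
  define u where "u i j = u' (i, j)" for i j
  have u: "real_of_int (det Abar) * Ai $$ (i, j) = real_of_int (u i j)" "\<bar>u i j\<bar> \<le> N ^ n"
    if "i < n" "j < n" for i j
    using u'[OF that] by (auto simp: u_def)
  have u_abs: "D * \<bar>Ai $$ (i, j)\<bar> = \<bar>real_of_int (u i j)\<bar>" if "i < n" "j < n" for i j
    using u(1)[OF that] by (simp add: D_def abs_mult[symmetric])
  define M where "M = mat n n (\<lambda>(j, i). (if i = j then p * D else 0) - q * \<bar>u i j\<bar>)"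
  define v where "v = vec n (\<lambda>_. q * D)"
  let ?K = "int s * N ^ n"
  have s: "int s = \<bar>p\<bar> + q" using q by (simp add: s_def)
  have M: "M \<in> carrier_mat n n" and v: "v \<in> carrier_vec n" by (auto simp: M_def v_def)
  have M_eq: "map_mat real_of_int M = (real_of_int q * D) \<cdot>\<^sub>m (\<rho> \<cdot>\<^sub>m 1\<^sub>m n - transpose_mat (abs_mat Ai))"
    using inv_A(1) q by (intro eq_matI) (auto simp: M_def \<rho>_eq u_abs field_simps)
  have "det (map_mat real_of_int M) \<noteq> 0"
    unfolding M_eq det_smult using q D inv_A(1)
      invertible_mat_det_nonzero[OF _ weight_matrix_invertible[OF absAi radius], of n]
    by (simp add: minus_carrier_mat)
  then have m: "det M \<noteq> 0" by (simp add: of_int_hom.hom_det)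
  have Mw: "map_mat real_of_int M *\<^sub>v w = map_vec real_of_int v"
    unfolding M_eq using inv_A(1) w
    by (subst smult_mat_mult_vec[of _ n n]) (auto simp: w_eq v_def minus_carrier_mat)
  have boundM: "\<bar>M $$ (i, j)\<bar> \<le> ?K" if "i < n" "j < n" for i j
  proof -
    have "\<bar>M $$ (i, j)\<bar> \<le> \<bar>p\<bar> * D + q * \<bar>u j i\<bar>"
      using that q D(1) by (auto simp: M_def abs_mult intro!: order_trans[OF abs_triangle_ineq4])
    also have "\<dots> \<le> \<bar>p\<bar> * N ^ n + q * N ^ n"
      using that q D u(2) by (intro add_mono mult_left_mono) auto
    finally show ?thesis by (simp add: s distrib_right)
  qed
  have boundv: "\<bar>v $ i\<bar> \<le> ?K" if "i < n" for i
  proof -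
    have "q * D \<le> int s * N ^ n" using D q N_ge by (intro mult_mono) (auto simp: s)
    then show ?thesis using that D q by (simp add: v_def abs_mult)
  qed
  have "\<forall>k\<in>{..<n}. \<exists>a. real_of_int (det M) * w $ k = real_of_int a \<and> \<bar>a\<bar> \<le> E"
    unfolding E_def using cramer_int[OF M v w Mw _ boundM boundv] by auto
  from bchoice[OF this] obtain a where
    "\<And>k. k < n \<Longrightarrow> real_of_int (det M) * w $ k = real_of_int (a k)" "\<And>k. k < n \<Longrightarrow> \<bar>a k\<bar> \<le> E"
    by auto
  then show ?thesis using that[OF m] abs_det_le[OF M boundM] by (simp add: E_def)
qed

lemma w_rat: "k < n \<Longrightarrow> w $ k \<in> \<rat>"
proof -
  assume k: "k < n"
  obtain m a where m: "m \<noteq> 0" "real_of_int m * w $ k = real_of_int (a k)"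
    using weight_integer k by metis
  then have "w $ k = real_of_int (a k) / real_of_int m" by (simp add: field_simps)
  then show ?thesis by simp
qed

text \<open>Conjugation by \<open>W\<close> fixes the diagonal matrix \<open>Z\<close>, so the
  preconditioning can be undone: \<open>db * x / w\<close> solves an integer system that does not
  involve the weights. They reappear only as a factor in front of the numerators.\<close>

lemma x_vec_integer:
  assumes z: "sign_vec n z"
  obtains d :: int and a :: "nat \<Rightarrow> int" where "d \<noteq> 0" "\<bar>d\<bar> \<le> F"
    "\<And>k. k < n \<Longrightarrow> real_of_int (d * db) * x_vec At bt z $ k = w $ k * real_of_int (a k)"
    "\<And>k. k < n \<Longrightarrow> \<bar>a k\<bar> \<le> F"
proof -
  let ?x = "x_vec At bt z"
  note zc = sign_vec_carrier[OF z] and xc = x_vec_carrier[OF z]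
  \<comment> \<open>The floor only converts the signs to integers.\<close>
  define M where "M = mat n n (\<lambda>(i, j). Abar $$ (i, j) - (if i = j then dA * \<lfloor>z $ j\<rfloor> else 0))"
  define v where "v = vec n (\<lambda>i. dA * bbar $ i)"
  define y where "y = vec n (\<lambda>i. real_of_int db * ?x $ i / w $ i)"
  have M: "M \<in> carrier_mat n n" and v: "v \<in> carrier_vec n" and y: "y \<in> carrier_vec n"
    by (auto simp: M_def v_def y_def)
  have zi: "real_of_int \<lfloor>z $ i\<rfloor> = z $ i" if "i < n" for i
    using sign_vec_cases[OF z that] by (metis floor_of_int of_int_1 of_int_minus)
  \<comment> \<open>In matrix form, \<open>W M u = dA (At - Z) W u\<close>; it carries both the
    invertibility and the solution over to \<open>M\<close>.\<close>
  have Mu: "w $ i * (map_mat real_of_int M *\<^sub>v u) $ i =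
      dA * ((At - Diag z) *\<^sub>v vec n (\<lambda>i. w $ i * u $ i)) $ i"
    if u: "u \<in> carrier_vec n" and i: "i < n" for u i
  proof -
    have "(map_mat real_of_int M *\<^sub>v u) $ i = (\<Sum>j<n. dA * (A $$ (i, j) * u $ j) - (if i = j then dA * z $ j else 0) * u $ j)"
      using index_mult_mat_vec_sum[of "map_mat real_of_int M" n n u i] M u i zi dA(1) Abar
      by (auto simp: M_def A_eq left_diff_distrib intro!: sum.cong simp del: index_mult_mat_vec)
    then have 1: "(map_mat real_of_int M *\<^sub>v u) $ i = dA * ((\<Sum>j<n. A $$ (i, j) * u $ j) - z $ i * u $ i)"
      using i by (simp add: sum_subtractf sum_of_bool_mult_index sum_distrib_left[symmetric] right_diff_distrib mult.assoc)
    have "(\<Sum>j<n. At $$ (i, j) * (w $ j * u $ j)) = w $ i * (\<Sum>j<n. A $$ (i, j) * u $ j)"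
      unfolding sum_distrib_left using w w_pos i
      by (intro sum.cong) (auto simp: diag_conj_index less_imp_neq[symmetric])
    then have 2: "((At - Diag z) *\<^sub>v vec n (\<lambda>i. w $ i * u $ i)) $ i = w $ i * (\<Sum>j<n. A $$ (i, j) * u $ j) - z $ i * (w $ i * u $ i)"
      using index_sub_Diag_mult_vec[OF diag_conj_carrier[OF w] zc, of "vec n (\<lambda>i. w $ i * u $ i)" i A] i by simp
    show ?thesis unfolding 1 2 by (simp add: algebra_simps)
  qed
  have "invertible_mat (map_mat real_of_int M)"
  proof (rule invertible_matI_kernel)
    show "map_mat real_of_int M \<in> carrier_mat n n" using M by simp
    fix u assume u: "u \<in> carrier_vec n" and 0: "map_mat real_of_int M *\<^sub>v u = 0\<^sub>v n"
    let ?wu = "vec n (\<lambda>i. w $ i * u $ i)"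
    have c: "At - Diag z \<in> carrier_mat n n" using diag_conj_carrier[OF w] zc by (simp add: minus_carrier_mat)
    have "(At - Diag z) *\<^sub>v ?wu = 0\<^sub>v n"
    proof (rule eq_vecI)
      fix i assume "i < dim_vec (0\<^sub>v n :: real vec)"
      then show "((At - Diag z) *\<^sub>v ?wu) $ i = 0\<^sub>v n $ i" using Mu[OF u, of i] 0 dA(1) by simp
    qed (use c zc in simp)
    then have "H_mat At z *\<^sub>v ((At - Diag z) *\<^sub>v ?wu) = 0\<^sub>v n"
      using H_mat(1)[OF z] by (intro eq_vecI) auto
    moreover have "H_mat At z *\<^sub>v ((At - Diag z) *\<^sub>v ?wu) = ?wu"
      using H_mat(1,3)[OF z] c by (simp flip: assoc_mult_mat_vec)
    ultimately have wu: "?wu = 0\<^sub>v n" by simp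
    have "u $ i = 0" if "i < n" for i
      using arg_cong[OF wu, of "\<lambda>v. v $ i"] w_pos[OF that] that by simp
    then show "u = 0\<^sub>v n" using u by (intro eq_vecI) simp_all
  qed
  then have d: "det M \<noteq> 0"
    using invertible_mat_det_nonzero[of "map_mat real_of_int M" n] M by (simp add: of_int_hom.hom_det)
  have My: "map_mat real_of_int M *\<^sub>v y = map_vec real_of_int v"
  proof (rule eq_vecI)
    fix i assume "i < dim_vec (map_vec real_of_int v)"
    then have i: "i < n" by (simp add: v_def)
    have "vec n (\<lambda>i. w $ i * y $ i) = real_of_int db \<cdot>\<^sub>v ?x"
      using xc w_pos by (intro eq_vecI) (auto simp: y_def less_imp_neq[symmetric])
    then have "(At - Diag z) *\<^sub>v vec n (\<lambda>i. w $ i * y $ i) = real_of_int db \<cdot>\<^sub>v bt"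
      using mult_mat_vec[OF _ xc, of "At - Diag z" n] diag_conj_carrier[OF w, of A] zc x_vec[OF z]
      by (simp add: minus_carrier_mat)
    moreover have "(real_of_int db \<cdot>\<^sub>v bt) $ i = real_of_int db * (w $ i * b $ i)"
      using index_smult_vec(1)[of i bt "real_of_int db"] carrier_vecD[OF bt(1)] bt(2)[OF i] i by (simp only:)
    moreover have "real_of_int db * b $ i = bbar $ i" using i bbar db(1) by (simp add: b_eq)
    ultimately have eq: "w $ i * (map_mat real_of_int M *\<^sub>v y) $ i = w $ i * (dA * bbar $ i)"
      using Mu[OF y i] by (simp add: mult_ac del: index_mult_mat_vec)
    have "w $ i \<noteq> 0" using w_pos[OF i] by simp
    from mult_left_cancel[OF this, THEN iffD1, OF eq]
    show "(map_mat real_of_int M *\<^sub>v y) $ i = map_vec real_of_int v $ i"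
      unfolding v_def using i by (simp only: index_map_vec index_vec dim_vec)
  qed (use M in \<open>simp add: v_def\<close>)
  have LL: "L \<le> L ^ 2" "dA * L \<le> L ^ 2"
    using mult_right_mono[OF N_ge(4), of L] mult_right_mono[OF dA(2), of L] N_ge(4)
    by (simp_all add: power2_eq_square)
  \<comment> \<open>One constant has to cover both the matrix entries, which are at most
    \<open>2 * L\<close>, and the right-hand side, which is at most \<open>L ^ 2\<close>.\<close>
  have boundM: "\<bar>M $$ (i, j)\<bar> \<le> 2 * L ^ 2" if "i < n" "j < n" for i j
  proof -
    have "\<lfloor>z $ j\<rfloor> = 1 \<or> \<lfloor>z $ j\<rfloor> = - 1" using zi[OF that(2)] sign_vec_cases[OF z that(2)] by linarith
    then show ?thesis using that Abar_le[OF that] dA LL(1) by (auto simp: M_def)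
  qed
  have boundv: "\<bar>v $ i\<bar> \<le> 2 * L ^ 2" if "i < n" for i
  proof -
    have "dA * \<bar>bbar $ i\<bar> \<le> dA * L" using dA bbar_le[OF that] by (intro mult_left_mono) auto
    moreover have "\<bar>v $ i\<bar> = dA * \<bar>bbar $ i\<bar>" using that dA by (simp add: v_def abs_mult)
    ultimately show ?thesis using LL N_ge(4) by linarith
  qed
  have "\<forall>k\<in>{..<n}. \<exists>a. real_of_int (det M) * y $ k = real_of_int a \<and> \<bar>a\<bar> \<le> F"
    unfolding F_def using cramer_int[OF M v y My _ boundM boundv] by auto
  from bchoice[OF this] obtain a where
    a: "\<And>k. k < n \<Longrightarrow> real_of_int (det M) * y $ k = real_of_int (a k)" "\<And>k. k < n \<Longrightarrow> \<bar>a k\<bar> \<le> F"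
    by auto
  have x_eq: "real_of_int (det M * db) * ?x $ k = w $ k * real_of_int (a k)" if "k < n" for k
    using a(1)[OF that] w_pos[OF that] that by (simp add: y_def field_simps)
  have "\<bar>det M\<bar> \<le> F" unfolding F_def by (rule abs_det_le[OF M boundM])
  from that[OF d this x_eq a(2)] show ?thesis by simp
qed

lemma E_nonneg: "0 \<le> E" and F_nonneg: "0 \<le> F"
  using N_ge by (simp_all add: E_def F_def)

text \<open>Nonzero integer denominators have modulus at least one, so the weights are bounded by
  their numerators and each entry of \<open>x\<close> by \<open>w $ k\<close> times its
  numerator.\<close>

lemma abs_potential_le:
  assumes z: "sign_vec n z"
  shows "\<bar>potential z\<bar> \<le> real n * (E * F)"
proof -
  obtain d c where d: "d \<noteq> 0" "\<And>k. k < n \<Longrightarrow> real_of_int (d * db) * x_vec At bt z $ k = w $ k * real_of_int (c k)"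
    "\<And>k. k < n \<Longrightarrow> \<bar>c k\<bar> \<le> F" using x_vec_integer[OF z] by metis
  obtain m a where m: "m \<noteq> 0" "\<And>k. k < n \<Longrightarrow> real_of_int m * w $ k = real_of_int (a k)" "\<And>k. k < n \<Longrightarrow> \<bar>a k\<bar> \<le> E"
    using weight_integer by metis
  have abs_le: "\<bar>t\<bar> \<le> \<bar>real_of_int k * t\<bar>" if "k \<noteq> 0" for k :: int and t :: real
  proof -
    have "1 * \<bar>t\<bar> \<le> \<bar>real_of_int k\<bar> * \<bar>t\<bar>" using that by (intro mult_right_mono) linarith+
    then show ?thesis by (simp add: abs_mult)
  qed
  have "\<bar>z $ k * x_vec At bt z $ k\<bar> \<le> E * F" if k: "k < n" for k
  proof -
    have "\<bar>w $ k\<bar> \<le> E" using abs_le[OF m(1), of "w $ k"] m(2,3)[OF k] by (simp flip: of_int_abs)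
    moreover have "\<bar>real_of_int (c k)\<bar> \<le> F" using d(3)[OF k] by linarith
    moreover have "\<bar>x_vec At bt z $ k\<bar> \<le> \<bar>w $ k\<bar> * \<bar>real_of_int (c k)\<bar>"
      using abs_le[of "d * db" "x_vec At bt z $ k"] d(1) db(1) unfolding d(2)[OF k] abs_mult by simp
    ultimately have "\<bar>x_vec At bt z $ k\<bar> \<le> real_of_int E * real_of_int F"
      using E_nonneg by (elim order_trans) (intro mult_mono, auto)
    then show ?thesis using sign_vec_cases[OF z k] by auto
  qed
  then have "\<bar>potential z\<bar> \<le> (\<Sum>k<n. real_of_int (E * F))"
    unfolding potential_def by (intro order_trans[OF sum_abs] sum_mono) auto
  then show ?thesis by simp
qed

text \<open>The denominator \<open>m\<close> of the weights is shared by all sign vectors, so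
  \<open>m * d * d' * db\<close> clears both potentials. The gap becomes a nonzero integer, of
  modulus at least one.\<close>

lemma potential_gap_ge:
  assumes z: "sign_vec n z" and z': "sign_vec n z'" and less: "potential z < potential z'"
  shows "1 \<le> real_of_int (E * F * F * L) * (potential z' - potential z)"
proof -
  obtain m a where m: "m \<noteq> 0" "\<bar>m\<bar> \<le> E" "\<And>k. k < n \<Longrightarrow> real_of_int m * w $ k = real_of_int (a k)"
    using weight_integer by metis
  have int: "\<exists>d::int. d \<noteq> 0 \<and> \<bar>d\<bar> \<le> F \<and> real_of_int (m * d * db) * potential y \<in> \<int>" if y: "sign_vec n y" for y
  proof -
    obtain d c where d: "d \<noteq> 0" "\<bar>d\<bar> \<le> F" "\<And>k. k < n \<Longrightarrow> real_of_int (d * db) * x_vec At bt y $ k = w $ k * real_of_int (c k)"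
      using x_vec_integer[OF y] by metis
    have "real_of_int (m * d * db) * potential y = (\<Sum>k<n. y $ k * (real_of_int m * (real_of_int (d * db) * x_vec At bt y $ k)))"
      by (simp add: potential_def sum_distrib_left mult_ac)
    also have "\<dots> = (\<Sum>k<n. y $ k * (real_of_int (a k) * real_of_int (c k)))"
      using d(3) m(3) by (intro sum.cong) (simp_all add: mult.assoc[symmetric])
    also have "\<dots> \<in> \<int>"
    proof (intro Ints_sum Ints_mult Ints_of_int)
      fix k assume "k \<in> {..<n}"
      then show "y $ k \<in> \<int>" using sign_vec_cases[OF y, of k] by auto
    qed
    finally show ?thesis using d by blast
  qed
  obtain d where d: "d \<noteq> 0" "\<bar>d\<bar> \<le> F" "real_of_int (m * d * db) * potential z \<in> \<int>" using int[OF z] by blast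
  obtain d' where d': "d' \<noteq> 0" "\<bar>d'\<bar> \<le> F" "real_of_int (m * d' * db) * potential z' \<in> \<int>" using int[OF z'] by blast
  let ?gap = "potential z' - potential z"
  have "real_of_int (m * d * d' * db) * ?gap =
      d * (real_of_int (m * d' * db) * potential z') - d' * (real_of_int (m * d * db) * potential z)"
    by (simp add: algebra_simps)
  then have "real_of_int (m * d * d' * db) * ?gap \<in> \<int>" using d(3) d'(3) by auto
  moreover have "real_of_int (m * d * d' * db) * ?gap \<noteq> 0" using m d d' db less by simp
  ultimately have "1 \<le> \<bar>real_of_int (m * d * d' * db) * ?gap\<bar>" by (rule Ints_nonzero_abs_ge1)
  also have "\<dots> = real_of_int (\<bar>m\<bar> * \<bar>d\<bar> * \<bar>d'\<bar> * db) * ?gap"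
    using less db by (simp add: abs_mult)
  also have "\<dots> \<le> real_of_int (E * F * F * L) * ?gap"
    using m d d' db less E_nonneg F_nonneg
    by (intro mult_right_mono of_int_le_iff[THEN iffD2] mult_mono) auto
  finally show ?thesis .
qed

text \<open>The left side is \<open>2 * n * L\<close> times \<open>E ^ 2 * F ^ 3\<close>, with
  \<open>E <= N ^ ((1 + s + n) * n)\<close> and \<open>F <= N ^ (3 * n)\<close>. The exponent is at
  most \<open>2 + 11 * n + 2 * s * n + 2 * n ^ 2\<close>, whence the 15.\<close>

lemma magnitude_le: "2 * (int n * (E * F)) * (E * F * F * L) \<le> N ^ ((2 * s + 15) * n\<^sup>2)"
proof -
  have N1: "1 \<le> N" using N_ge by simp
  have "int s \<le> 2 ^ s" by (metis less_exp of_nat_less_numeral_power_cancel_iff less_imp_le)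
  also have "\<dots> \<le> N ^ s" using N_ge by (intro power_mono) auto
  finally have "int n * (int s * N ^ n) \<le> N * (N ^ s * N ^ n)"
    using N_ge by (intro mult_mono) auto
  then have "E \<le> (N * (N ^ s * N ^ n)) ^ n"
    unfolding E_def using N_ge by (intro power_mono) auto
  then have E: "E \<le> N ^ ((1 + (s + n)) * n)" by (simp add: power_mult power_add power_mult_distrib)
  have "int n * (2 * L ^ 2) = 2 * (int n * L) * L" by (simp add: power2_eq_square)
  also have "\<dots> \<le> N * N * N" using N_ge unfolding N_def[symmetric] by (intro mult_mono) auto
  finally have "F \<le> (N * N * N) ^ n"
    unfolding F_def using N_ge by (intro power_mono) auto
  then have F: "F \<le> N ^ (3 * n)" by (simp add: power_mult power3_eq_cube)
  have EF: "E * F \<le> N ^ ((1 + (s + n)) * n) * N ^ (3 * n)" using E F E_nonneg F_nonneg N1 by (intro mult_mono) auto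
  have "2 * (int n * (E * F)) * (E * F * F * L) = 2 * (int n * L) * ((E * F) * (E * F) * F)"
    by (simp add: mult_ac)
  also have "\<dots> \<le> N * N * ((N ^ ((1 + (s + n)) * n) * N ^ (3 * n)) * (N ^ ((1 + (s + n)) * n) * N ^ (3 * n)) * N ^ (3 * n))"
    using E_nonneg F_nonneg N_ge unfolding N_def[symmetric] by (intro mult_mono EF F) auto
  also have "\<dots> = N ^ (2 + (((1 + (s + n)) * n + 3 * n) + ((1 + (s + n)) * n + 3 * n) + 3 * n))"
    by (simp only: power_add power2_eq_square)
  also have "\<dots> \<le> N ^ ((2 * s + 15) * n\<^sup>2)"
  proof (rule power_increasing[OF _ N1])
    have "1 \<le> n * n" "n \<le> n * n" using n0 by simp_all
    moreover from this(2) have "s * n \<le> s * (n * n)" by (rule mult_le_mono2)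
    moreover have "2 + (((1 + (s + n)) * n + 3 * n) + ((1 + (s + n)) * n + 3 * n) + 3 * n) =
        2 + 11 * n + 2 * (s * n) + 2 * (n * n)" by (simp add: algebra_simps)
    moreover have "(2 * s + 15) * n\<^sup>2 = 2 * (s * (n * n)) + 15 * (n * n)"
      by (simp add: algebra_simps power2_eq_square)
    ultimately show "2 + (((1 + (s + n)) * n + 3 * n) + ((1 + (s + n)) * n + 3 * n) + 3 * n) \<le> (2 * s + 15) * n\<^sup>2"
      by linarith
  qed
  finally show ?thesis .
qed

lemma iterations_le:
  assumes prog: "progress R c" and c: "0 < c" "c \<le> 1"
  shows "iterations_le At bt R (((2 * real s + 15) / (1 - 2 * \<rho>) + 2) * real n ^ 2 * ln (real n * real_of_int L) / c)"
  unfolding iterations_le_def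
proof (intro allI impI)
  fix zs T assume run: "sign_flip_run At bt R zs T"
  let ?l = "ln (real n * real_of_int L)" and ?\<kappa> = "1 - 2 * \<rho>"
  have N: "real n * real_of_int L = real_of_int N" by (simp add: N_def)
  have "ln 2 \<le> ?l" unfolding N using N_ge(1) by simp
  \<comment> \<open>From \<open>ln t <= t - 1\<close> at \<open>t = 1 / 2\<close>.\<close>
  moreover have "1 / 2 \<le> ln (2 :: real)" using ln_le_minus_one[of "1 / 2 :: real"] by (simp add: ln_div)
  ultimately have l: "1 \<le> 2 * ?l" by linarith
  have n2: "1 \<le> real n ^ 2" using n0 by simp
  have nl: "1 \<le> 2 * (real n ^ 2 * ?l)" using mult_mono[OF n2 l] by simp
  have \<kappa>: "0 < ?\<kappa>" using \<rho>_half by simp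
  show "real T \<le> ((2 * real s + 15) / ?\<kappa> + 2) * real n ^ 2 * ?l / c"
  proof (cases T)
    case 0
    then show ?thesis using l \<kappa> c by simp
  next
    case (Suc t)
    \<comment> \<open>Both numbers bound the modulus of a nonzero integer denominator.\<close>
    have "0 \<noteq> E" "0 \<noteq> F"
      using weight_integer x_vec_integer[of "vec n (\<lambda>_. 1)"] unfolding sign_vec_def
      by (force, force)
    then have EF: "0 < E" "0 < F" using E_nonneg F_nonneg by auto
    then have Q0: "0 < real_of_int (E * F * F * L)" using N_ge by simp
    have "real t * (c * ?\<kappa>) \<le> ln (2 * (real n * (E * F)) * real_of_int (E * F * F * L))"
      using abs_potential_le Q0 potential_gap_ge run unfolding Suc
      by (intro iterations_bound[OF prog c]) auto
    also have "\<dots> \<le> ln (real_of_int N ^ ((2 * s + 15) * n\<^sup>2))"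
    proof (rule ln_mono)
      have "real_of_int (2 * (int n * (E * F)) * (E * F * F * L)) \<le> real_of_int (N ^ ((2 * s + 15) * n\<^sup>2))"
        using magnitude_le by (rule of_int_le_iff[THEN iffD2])
      then show "2 * (real n * (E * F)) * real_of_int (E * F * F * L) \<le> real_of_int N ^ ((2 * s + 15) * n\<^sup>2)"
        by simp
      show "0 < 2 * (real n * (E * F)) * real_of_int (E * F * F * L)"
        using Q0 n0 EF by simp
    qed
    also have "\<dots> = (2 * real s + 15) * (real n ^ 2 * ?l)"
      using N_ge by (simp add: ln_realpow N)
    finally have "real t * c \<le> (2 * real s + 15) / ?\<kappa> * (real n ^ 2 * ?l)"
      using \<kappa> by (simp add: field_simps)
    \<comment> \<open>\<open>iterations_bound\<close> counts one iteration less than the run has.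
      The missing one is paid for by the summand 2 in the constant.\<close>
    moreover have "c \<le> 2 * (real n ^ 2 * ?l)" using nl c by linarith
    ultimately have "(real t + 1) * c \<le> ((2 * real s + 15) / ?\<kappa> + 2) * (real n ^ 2 * ?l)"
      by (simp only: distrib_right)
    then show ?thesis unfolding Suc using c by (simp add: field_simps)
  qed
qed

lemma iterations_le_inverse:
  "progress R (1 / real n) \<Longrightarrow>
    iterations_le At bt R (((2 * real s + 15) / (1 - 2 * \<rho>) + 2) * real n ^ 2 * ln (real n * real_of_int L) * real n)"
  using iterations_le[of R "1 / real n"] n0 by simp

end

section \<open>The integer norms and the final statement\<close>

lemma abs_le_max_norm_mat:
  assumes "i < dim_row M" "j < dim_col M"
  shows "\<bar>M $$ (i, j)\<bar> \<le> max_norm_mat M"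
  unfolding max_norm_mat_def
proof (rule Max_ge)
  have "{\<bar>M $$ (i, j)\<bar> | i j. i < dim_row M \<and> j < dim_col M} =
      (\<lambda>(i, j). \<bar>M $$ (i, j)\<bar>) ` ({..<dim_row M} \<times> {..<dim_col M})" by auto
  then show "finite {\<bar>M $$ (i, j)\<bar> | i j. i < dim_row M \<and> j < dim_col M}" by simp
qed (use assms in auto)

lemma abs_le_inf_norm_vec:
  assumes "i < dim_vec v"
  shows "\<bar>v $ i\<bar> \<le> inf_norm_vec v"
  unfolding inf_norm_vec_def
proof (rule Max_ge)
  have "{\<bar>v $ i\<bar> | i. i < dim_vec v} = (\<lambda>i. \<bar>v $ i\<bar>) ` {..<dim_vec v}" by auto
  then show "finite {\<bar>v $ i\<bar> | i. i < dim_vec v}" by simp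
qed (use assms in auto)

theorem theorem4p3:
  fixes rhobar rhoQ :: real
  assumes "rhobar < 1 / 2" and "rhoQ \<in> \<rat>" and "rhobar < rhoQ" and "rhoQ < 1 / 2"
  shows "\<exists>C>0. \<forall>(n :: nat) (A :: real mat) (b :: real vec) (Abar :: int mat) (bbar :: int vec)
      (dA :: int) (db :: int) (L :: int).
    n > 0 \<and>
    A \<in> carrier_mat n n \<and> b \<in> carrier_vec n \<and>
    Abar \<in> carrier_mat n n \<and> bbar \<in> carrier_vec n \<and> dA > 0 \<and> db > 0 \<and>
    A = (1 / real_of_int dA) \<cdot>\<^sub>m map_mat real_of_int Abar \<and>
    b = (1 / real_of_int db) \<cdot>\<^sub>v map_vec real_of_int bbar \<and>
    L = Max {db, dA, inf_norm_vec bbar, max_norm_mat Abar} \<and>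
    invertible_mat A \<and>
    real_spectral_radius (abs_mat (inv_mat A)) \<le> rhobar
    \<longrightarrow>
    (\<exists>!w. w \<in> carrier_vec n \<and>
       (rhoQ \<cdot>\<^sub>m 1\<^sub>m n - transpose_mat (abs_mat (inv_mat A))) *\<^sub>v w = vec n (\<lambda>_. 1)) \<and>
    (\<forall>w. w \<in> carrier_vec n \<and>
       (rhoQ \<cdot>\<^sub>m 1\<^sub>m n - transpose_mat (abs_mat (inv_mat A))) *\<^sub>v w = vec n (\<lambda>_. 1)
       \<longrightarrow>
       (\<forall>i<n. w $ i > 0 \<and> w $ i \<in> \<rat>) \<and>
       (let W = Diag w;
            At = W * A * inv_mat W;
            bt = W *\<^sub>v b;
            bound = C * real n ^ 2 * ln (real n * real_of_int L)
        in
          (norm1_mat (inv_mat At) \<le> rhoQ \<and> rhoQ < 1 / 2) \<and>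
          sign_flip_finds_unique_solution At bt \<and>
          (\<forall>c :: nat \<Rightarrow> real. (\<forall>m>0. 0 < c m \<and> c m \<le> 1) \<longrightarrow>
             iterations_le At bt (capture_rule (c n)) (bound / c n)) \<and>
          iterations_le At bt steepest_rule (bound * real n) \<and>
          iterations_le At bt gauss_southwell_rule (bound * real n) \<and>
          iterations_le At bt full_flip_rule bound))"
proof -
  from assms(2) obtain p q :: int where pq: "0 < q" "rhoQ = real_of_int p / real_of_int q"
    by (metis Rats_cases')
  \<comment> \<open>The constant is fixed before the dimension and the data. It depends on
    \<open>rhoQ\<close> and its representation \<open>p / q\<close> only;
    \<open>\<bar>p\<bar> + q\<close> is the \<open>s\<close> of \<open>weighted_ave\<close>.\<close>
  define C where "C = (2 * real (nat (\<bar>p\<bar> + q)) + 15) / (1 - 2 * rhoQ) + 2"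
  have C: "0 < C" unfolding C_def using assms(4) by (intro add_nonneg_pos divide_nonneg_pos) auto
  have radius: "real_spectral_radius (abs_mat B) < rhoQ" if "real_spectral_radius (abs_mat B) \<le> rhobar" for B
    using that assms(3) by simp
  show ?thesis
  proof (intro exI[of _ C] conjI C allI impI)
    fix n :: nat and A :: "real mat" and b :: "real vec" and Abar :: "int mat" and bbar :: "int vec"
      and dA db L :: int
    assume hyps: "n > 0 \<and>
      A \<in> carrier_mat n n \<and> b \<in> carrier_vec n \<and>
      Abar \<in> carrier_mat n n \<and> bbar \<in> carrier_vec n \<and> dA > 0 \<and> db > 0 \<and>
      A = (1 / real_of_int dA) \<cdot>\<^sub>m map_mat real_of_int Abar \<and>
      b = (1 / real_of_int db) \<cdot>\<^sub>v map_vec real_of_int bbar \<and>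
      L = Max {db, dA, inf_norm_vec bbar, max_norm_mat Abar} \<and>
      invertible_mat A \<and>
      real_spectral_radius (abs_mat (inv_mat A)) \<le> rhobar"
    then have A: "A \<in> carrier_mat n n" and inv: "invertible_mat A"
      and rad: "real_spectral_radius (abs_mat (inv_mat A)) \<le> rhobar" by blast+
    show "\<exists>!w. w \<in> carrier_vec n \<and>
       (rhoQ \<cdot>\<^sub>m 1\<^sub>m n - transpose_mat (abs_mat (inv_mat A))) *\<^sub>v w = vec n (\<lambda>_. 1)"
      by (rule weight_exists1[OF _ _ radius[OF rad]]) (use inv_mat(1)[OF A inv] in auto)
  next
    fix n :: nat and A :: "real mat" and b w :: "real vec" and Abar :: "int mat" and bbar :: "int vec"
      and dA db L :: int
    assume hyps: "n > 0 \<and>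
      A \<in> carrier_mat n n \<and> b \<in> carrier_vec n \<and>
      Abar \<in> carrier_mat n n \<and> bbar \<in> carrier_vec n \<and> dA > 0 \<and> db > 0 \<and>
      A = (1 / real_of_int dA) \<cdot>\<^sub>m map_mat real_of_int Abar \<and>
      b = (1 / real_of_int db) \<cdot>\<^sub>v map_vec real_of_int bbar \<and>
      L = Max {db, dA, inf_norm_vec bbar, max_norm_mat Abar} \<and>
      invertible_mat A \<and>
      real_spectral_radius (abs_mat (inv_mat A)) \<le> rhobar"
    assume w: "w \<in> carrier_vec n \<and>
      (rhoQ \<cdot>\<^sub>m 1\<^sub>m n - transpose_mat (abs_mat (inv_mat A))) *\<^sub>v w = vec n (\<lambda>_. 1)"
    have L: "db \<le> L" "dA \<le> L" "inf_norm_vec bbar \<le> L" "max_norm_mat Abar \<le> L" using hyps by simp_all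
    interpret weighted_ave n A b w Abar bbar dA db L p q rhoQ
    proof
      show "\<bar>Abar $$ (i, j)\<bar> \<le> L" if "i < n" "j < n" for i j
        using abs_le_max_norm_mat[of i Abar j] L(4) that hyps by auto
      show "\<bar>bbar $ i\<bar> \<le> L" if "i < n" for i
        using abs_le_inf_norm_vec[of i bbar] L(3) that hyps by auto
      show "real_spectral_radius (abs_mat (inv_mat A)) < rhoQ" using hyps by (intro radius) blast
    qed (use hyps w L assms(4) pq in blast)+
    show "0 < w $ i" "w $ i \<in> \<rat>" if "i < n" for i using w_pos[OF that] w_rat[OF that] .
    have At_eq: "Diag w * A * inv_mat (Diag w) = At"
    proof (rule Diag_conj)
      show "w $ i \<noteq> 0" if "i < n" for i using w_pos[OF that] by simp
    qed (use w A_carrier in auto)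
    have C_eq: "C = (2 * real s + 15) / (1 - 2 * rhoQ) + 2" by (simp add: C_def s_def)
    show "let W = Diag w;
            At = W * A * inv_mat W;
            bt = W *\<^sub>v b;
            bound = C * real n ^ 2 * ln (real n * real_of_int L)
        in
          (norm1_mat (inv_mat At) \<le> rhoQ \<and> rhoQ < 1 / 2) \<and>
          sign_flip_finds_unique_solution At bt \<and>
          (\<forall>c :: nat \<Rightarrow> real. (\<forall>m>0. 0 < c m \<and> c m \<le> 1) \<longrightarrow>
             iterations_le At bt (capture_rule (c n)) (bound / c n)) \<and>
          iterations_le At bt steepest_rule (bound * real n) \<and>
          iterations_le At bt gauss_southwell_rule (bound * real n) \<and>
          iterations_le At bt full_flip_rule bound"
      unfolding Let_def At_eq C_eq
    proof (intro conjI allI impI)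
      fix c :: "nat \<Rightarrow> real" assume "\<forall>m>0. 0 < c m \<and> c m \<le> 1"
      then show "iterations_le At bt (capture_rule (c n))
          (((2 * real s + 15) / (1 - 2 * rhoQ) + 2) * real n ^ 2 * ln (real n * real_of_int L) / c n)"
        using n0 by (intro iterations_le progress_capture) auto
    next
      show "iterations_le At bt full_flip_rule
          (((2 * real s + 15) / (1 - 2 * rhoQ) + 2) * real n ^ 2 * ln (real n * real_of_int L))"
        using iterations_le[OF progress_full] by simp
    qed (rule norm1_inv assms(4) finds_unique_solution
        iterations_le_inverse[OF progress_steepest] iterations_le_inverse[OF progress_gauss_southwell])+
  qed
qed

end
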